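(* Let $r \ge 1$, $i \ge 0$ and $k \ge 2$ be fixed integers satisfying either (a) $r \le 10$, $i + k \le 100$ and $2 \le k \le 27$, or (b) $i + k \le 29$ (with $r$ arbitrary). For each $n$, let $G$ be a random $r$-regular bipartite graph on $v = 2n$ vertices (uniformly distributed over such graphs), and let $m_j$ denote the number of $j$-matchings of $G$. Define $u(j) = -\ln(j!\, m_j)$ and let $\Delta$ be the forward difference operator, $\Delta u(j) = u(j+1) - u(j)$, so that $\Delta^k u(i) = \sum_{l=0}^{k} (-1)^{k-l}\binom{k}{l} u(i+l)$. Then \[ \mathrm{Prob}\bigl(\Delta^k u(i) \ge 0\bigr) \longrightarrow 1 \quad \text{as } n \to \infty. \]
   Context: A $j$-matching of a graph is a set of $j$ pairwise vertex-disjoint edges; $m_0 = 1$. Graphs are $r$-regular bipartite with $2n$ vertices ($n$ in each part); the probability is over a uniformly random such graph, with $r$, $i$, $k$ fixed while $n \to \infty$. *)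

theory Defs
  imports "HOL-Probability.Probability"
begin

(* A simple graph is given by its set of edges, each edge being a two-element set of vertices. *)

definition vertex_degree :: "'a set set \<Rightarrow> 'a \<Rightarrow> nat" where
  "vertex_degree E v = card {e \<in> E. v \<in> e}"

(* Labelled graphs: the two parts are the fixed n-element sets Inl ` {..<n} and Inr ` {..<n},
   so there are 2 * n vertices in total. *)
definition regular_bipartite_graphs :: "nat \<Rightarrow> nat \<Rightarrow> (nat + nat) set set set" where
  "regular_bipartite_graphs r n =
     {E. E \<subseteq> {{Inl a, Inr b} |a b. a < n \<and> b < n} \<and>
         (\<forall>v \<in> {..<n} <+> {..<n}. vertex_degree E v = r)}"

definition matchings :: "'a set set \<Rightarrow> nat \<Rightarrow> 'a set set set" where
  "matchings E j = {M. M \<subseteq> E \<and> finite M \<and> card M = j \<and> pairwise disjnt M}"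

definition num_matchings :: "'a set set \<Rightarrow> nat \<Rightarrow> nat" where
  "num_matchings E j = card (matchings E j)"

(* An r-regular bipartite graph with r > 0 and parts of size n has a j-matching for every j \<le> n,
   so the convention ln 0 = 0 only matters for n < j. *)
definition neg_ln_matchings :: "'a set set \<Rightarrow> nat \<Rightarrow> real" where
  "neg_ln_matchings E j = - ln (fact j * real (num_matchings E j))"

definition fwd_diff :: "(nat \<Rightarrow> real) \<Rightarrow> nat \<Rightarrow> real" where
  "fwd_diff f j = f (j + 1) - f j"

lemma fwd_diff_funpow:
  "(fwd_diff ^^ k) f i = (\<Sum>l=0..k. (-1) ^ (k - l) * real (k choose l) * f (i + l))"
proof (induction k arbitrary: i)
  case 0
  then show ?case by simp
next
  case (Suc k)
  let ?g = "\<lambda>l. (-1) ^ (k - l) * real (k choose l)"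
  have A: "(\<Sum>l=0..k. ?g l * f (i + 1 + l)) =
      (\<Sum>l=0..Suc k. (if l = 0 then 0 else ?g (l - 1) * f (i + l)))"
    by (subst sum.atLeast0_atMost_Suc_shift) simp
  have B: "(\<Sum>l=0..k. ?g l * f (i + l)) = (\<Sum>l=0..Suc k. ?g l * f (i + l))"
    by simp
  have C: "(if l = 0 then 0 else ?g (l - 1) * f (i + l)) - ?g l * f (i + l)
      = (-1) ^ (Suc k - l) * real (Suc k choose l) * f (i + l)" if "l \<in> {0..Suc k}" for l
  proof (cases l)
    case 0
    then show ?thesis by simp
  next
    case (Suc m)
    show ?thesis
    proof (cases "m = k")
      case True
      then show ?thesis using Suc by simp
    next
      case False
      then have "k - m = Suc (k - Suc m)" using that Suc by auto
      then show ?thesis using Suc by (simp add: algebra_simps)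
    qed
  qed
  have "(fwd_diff ^^ Suc k) f i = (fwd_diff ^^ k) f (i + 1) - (fwd_diff ^^ k) f i"
    by (simp add: fwd_diff_def)
  also have "\<dots> = (\<Sum>l=0..Suc k. (if l = 0 then 0 else ?g (l - 1) * f (i + l)) - ?g l * f (i + l))"
    unfolding Suc.IH A B sum_subtractf ..
  also have "\<dots> = (\<Sum>l=0..Suc k. (-1) ^ (Suc k - l) * real (Suc k choose l) * f (i + l))"
    using C by (intro sum.cong) auto
  finally show ?case .
qed

lemma finite_regular_bipartite_graphs: "finite (regular_bipartite_graphs r n)"
proof -
  have "{{Inl a, Inr b} |a b. a < n \<and> b < n} = (\<lambda>(a, b). {Inl a, Inr b}) ` ({..<n} \<times> {..<n})"
    by auto
  then have "finite {{Inl a, Inr b} |a b. a < n \<and> b < n}" by simp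
  then show ?thesis
    unfolding regular_bipartite_graphs_def by (rule rev_finite_subset[OF finite_Pow_iff[THEN iffD2]]) auto
qed

lemma num_matchings_0: "num_matchings E 0 = 1"
proof -
  have "matchings E 0 = {{}}" by (auto simp: matchings_def)
  then show ?thesis by (simp add: num_matchings_def)
qed

(* Uniform distribution; unspecified when there is no such graph, i.e. for n < r (if r > 0). *)
definition random_regular_bipartite_graph :: "nat \<Rightarrow> nat \<Rightarrow> (nat + nat) set set pmf" where
  "random_regular_bipartite_graph r n = pmf_of_set (regular_bipartite_graphs r n)"

end

theory Submission imports Defs begin

text \<open>Let \<open>M(t) = \<Sum>\<^sub>j m\<^sub>j t\<^sup>j\<close>. Deleting vertices one at a time gives \<open>t M'(t) / M(t) = \<Sum>\<^sub>a (1 - M\<^sub>G\<^sub>-\<^sub>a(t) / M\<^sub>G(t))\<close>,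
  summed over the \<open>n\<close> vertices \<open>a\<close> of one part, and the first \<open>s\<close> coefficients of each summand depend only on the
  ball of radius \<open>s\<close> around \<open>a\<close>. A switching argument bounds the expected number of vertices whose ball is
  not a tree, so with high probability \<open>t M'(t) / M(t) = n (D(t) + o(1))\<close> coefficientwise, where \<open>D\<close> is
  computed on the infinite \<open>r\<close>-regular tree.

  Put \<open>\<gamma>(j) = (j+1)! m\<^sub>j\<^sub>+\<^sub>1 / (n j! m\<^sub>j)\<close>. Comparing coefficients turns the last relation into a recursion for
  \<open>\<gamma>\<close> in which every term lagging \<open>s\<close> steps behind carries \<open>s\<close> factors \<open>j/n\<close>. It follows that
  \<open>n\<^sup>m \<Delta>\<^sup>m \<gamma>(j) \<rightarrow> m! [p\<^sup>m] G(p)\<close> for all \<open>m\<close> and \<open>j\<close>, where \<open>G(p) = r (1 - p)\<^sup>2 / (1 - p/r)\<close>. Hence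
  \<open>n\<^sup>k\<^sup>-\<^sup>1 \<Delta>\<^sup>k u(i)\<close> tends to \<open>- (k-2)! [p\<^sup>k\<^sup>-\<^sup>2] G'(p)/G(p) = (k-2)! (2 - r\<^sup>-\<^sup>(\<^sup>k\<^sup>-\<^sup>1\<^sup>)) > 0\<close>.\<close>

section \<open>Sequences with a power series scaling limit\<close>

text \<open>In the application \<open>x\<close> is a pair of a size and a graph, and
  \<open>\<nu> x\<close> is the size. The analysis below knows nothing of graphs.\<close>

locale scaling =
  fixes F :: "'x filter" and \<nu> :: "'x \<Rightarrow> real"
  assumes \<nu>_at_top: "filterlim \<nu> at_top F"
begin

text \<open>Discrete form of \<open>f x j\<close> being close to \<open>A\<close> at
  \<open>j / \<nu> x\<close>: for every m < K and each fixed j, the m-th difference of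
  \<open>f x\<close> at j, times \<open>\<nu> x ^ m\<close>, tends to m! [p^m] A. The limits do not
  depend on j, and \<open>A\<close> is purely formal.\<close>

primrec smooth_upto :: "nat \<Rightarrow> ('x \<Rightarrow> nat \<Rightarrow> real) \<Rightarrow> real fps \<Rightarrow> bool" where
  "smooth_upto 0 f A = True"
| "smooth_upto (Suc K) f A =
     ((\<forall>j. ((\<lambda>x. f x j) \<longlongrightarrow> fps_nth A 0) F) \<and>
      smooth_upto K (\<lambda>x j. \<nu> x * (f x (Suc j) - f x j)) (fps_deriv A))"

lemma inverse_\<nu>_tendsto: "((\<lambda>x. inverse (\<nu> x)) \<longlongrightarrow> 0) F"
  using tendsto_inverse_0_at_top[OF \<nu>_at_top] .

lemma eventually_\<nu>_gt: "eventually (\<lambda>x. \<nu> x > c) F"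
  using \<nu>_at_top unfolding filterlim_at_top_dense by blast

lemma smooth_upto_tendsto:
  "smooth_upto (Suc K) f A \<Longrightarrow> ((\<lambda>x. f x j) \<longlongrightarrow> fps_nth A 0) F"
  by simp

lemma smooth_upto_diff:
  "smooth_upto (Suc K) f A \<Longrightarrow>
    smooth_upto K (\<lambda>x j. \<nu> x * (f x (Suc j) - f x j)) (fps_deriv A)"
  by simp

lemma smooth_upto_SucD: "smooth_upto (Suc K) f A \<Longrightarrow> smooth_upto K f A"
proof (induction K arbitrary: f A)
  case (Suc K)
  show ?case
    using smooth_upto_tendsto[OF Suc.prems] Suc.IH[OF smooth_upto_diff[OF Suc.prems]]
    unfolding smooth_upto.simps(2)[of K] by blast
qed simp

lemma smooth_upto_cong:
  assumes "smooth_upto K f A" "\<And>j. eventually (\<lambda>x. f x j = g x j) F"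
  shows "smooth_upto K g A"
  using assms
proof (induction K arbitrary: f g A)
  case (Suc K)
  have "((\<lambda>x. g x j) \<longlongrightarrow> fps_nth A 0) F" for j
    using Suc.prems(1) tendsto_cong[OF Suc.prems(2)[of j]] by auto
  moreover have "smooth_upto K (\<lambda>x j. \<nu> x * (g x (Suc j) - g x j)) (fps_deriv A)"
  proof (rule Suc.IH[OF smooth_upto_diff[OF Suc.prems(1)]])
    fix j
    show "eventually (\<lambda>x. \<nu> x * (f x (Suc j) - f x j) = \<nu> x * (g x (Suc j) - g x j)) F"
      using Suc.prems(2)[of j] Suc.prems(2)[of "Suc j"] by eventually_elim simp
  qed
  ultimately show ?case by simp
qed simp

lemma smooth_upto_shift:
  "smooth_upto K f A \<Longrightarrow> smooth_upto K (\<lambda>x j. f x (Suc j)) A"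
proof (induction K arbitrary: f A)
  case (Suc K)
  show ?case
    using Suc.prems Suc.IH[OF smooth_upto_diff[OF Suc.prems]] by simp
qed simp

lemma smooth_upto_const:
  "(c \<longlongrightarrow> c0) F \<Longrightarrow> smooth_upto K (\<lambda>x j. c x) (fps_const c0)"
proof -
  have zero: "smooth_upto K (\<lambda>x j. 0) 0" for K
    by (induction K) auto
  show "(c \<longlongrightarrow> c0) F \<Longrightarrow> ?thesis"
    using zero by (cases K) auto
qed

lemma smooth_upto_add:
  "smooth_upto K f A \<Longrightarrow> smooth_upto K g B \<Longrightarrow> smooth_upto K (\<lambda>x j. f x j + g x j) (A + B)"
proof (induction K arbitrary: f A g B)
  case (Suc K)
  have "smooth_upto K (\<lambda>x j. \<nu> x * (f x (Suc j) - f x j) + \<nu> x * (g x (Suc j) - g x j))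
     (fps_deriv A + fps_deriv B)"
    by (intro Suc.IH smooth_upto_diff[OF Suc.prems(1)] smooth_upto_diff[OF Suc.prems(2)])
  moreover have "((\<lambda>x. f x j + g x j) \<longlongrightarrow> fps_nth (A + B) 0) F" for j
    using Suc.prems tendsto_add[of "\<lambda>x. f x j" _ F "\<lambda>x. g x j"] by simp
  ultimately show ?case by (simp add: algebra_simps)
qed simp

lemma smooth_upto_mult:
  "smooth_upto K f A \<Longrightarrow> smooth_upto K g B \<Longrightarrow> smooth_upto K (\<lambda>x j. f x j * g x j) (A * B)"
proof (induction K arbitrary: f A g B)
  case (Suc K)
  have f: "smooth_upto K f A" and g: "smooth_upto K g B"
    by (fact smooth_upto_SucD[OF Suc.prems(1)] smooth_upto_SucD[OF Suc.prems(2)])+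
  \<comment> \<open>Discrete product rule; the first term carries \<open>g\<close> at
    \<open>Suc j\<close>, hence the shift lemma.\<close>
  have "smooth_upto K (\<lambda>x j. \<nu> x * (f x (Suc j) - f x j) * g x (Suc j) + f x j * (\<nu> x * (g x (Suc j) - g x j)))
     (fps_deriv A * B + A * fps_deriv B)"
    by (intro smooth_upto_add Suc.IH f smooth_upto_shift[OF g]
        smooth_upto_diff[OF Suc.prems(1)] smooth_upto_diff[OF Suc.prems(2)])
  moreover have "((\<lambda>x. f x j * g x j) \<longlongrightarrow> fps_nth (A * B) 0) F" for j
    using Suc.prems tendsto_mult[of "\<lambda>x. f x j" _ F "\<lambda>x. g x j"] by simp
  ultimately show ?case by (simp add: algebra_simps)
qed simp

lemma smooth_upto_sum:
  assumes "\<And>s. s \<in> S \<Longrightarrow> smooth_upto K (f s) (A s)"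
  shows "smooth_upto K (\<lambda>x j. \<Sum>s\<in>S. f s x j) (\<Sum>s\<in>S. A s)"
  using assms
proof (induction S rule: infinite_finite_induct)
  case (insert s S)
  then show ?case by (simp add: smooth_upto_add)
qed (use smooth_upto_const[of "\<lambda>_. 0" 0 K] in auto)

lemma smooth_upto_power:
  "smooth_upto K f A \<Longrightarrow> smooth_upto K (\<lambda>x j. f x j ^ s) (A ^ s)"
proof (induction s)
  case 0
  then show ?case using smooth_upto_const[of "\<lambda>_. 1" 1 K] by simp
next
  case (Suc s)
  then show ?case by (simp add: smooth_upto_mult)
qed

lemma smooth_upto_inverse:
  assumes "smooth_upto K f A" "fps_nth A 0 \<noteq> 0"
  shows "smooth_upto K (\<lambda>x j. inverse (f x j)) (inverse A)"
  using assms
proof (induction K)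
  case (Suc K)
  have f: "smooth_upto K f A"
    by (fact smooth_upto_SucD[OF Suc.prems(1)])
  note inv = Suc.IH[OF f Suc.prems(2)]
  have ne: "eventually (\<lambda>x. f x j \<noteq> 0) F" for j
    by (rule tendsto_imp_eventually_ne[OF smooth_upto_tendsto[OF Suc.prems(1)] Suc.prems(2)])
  have "smooth_upto K (\<lambda>x j. (-1) * (\<nu> x * (f x (Suc j) - f x j) * (inverse (f x j) * inverse (f x (Suc j)))))
     (fps_const (-1) * (fps_deriv A * (inverse A * inverse A)))"
    by (intro smooth_upto_mult smooth_upto_diff[OF Suc.prems(1)] inv smooth_upto_shift[OF inv]
        smooth_upto_const tendsto_const)
  also have "fps_const (-1) * (fps_deriv A * (inverse A * inverse A)) = fps_deriv (inverse A)"
    using Suc.prems(2) by (simp add: fps_inverse_deriv power2_eq_square fps_const_neg[symmetric] del: fps_const_neg)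
  finally have "smooth_upto K (\<lambda>x j. \<nu> x * (inverse (f x (Suc j)) - inverse (f x j))) (fps_deriv (inverse A))"
  proof (rule smooth_upto_cong)
    fix j
    show "eventually (\<lambda>x. (-1) * (\<nu> x * (f x (Suc j) - f x j) * (inverse (f x j) * inverse (f x (Suc j))))
       = \<nu> x * (inverse (f x (Suc j)) - inverse (f x j))) F"
      using ne[of j] ne[of "Suc j"] by eventually_elim (simp add: field_simps)
  qed
  moreover have "((\<lambda>x. inverse (f x j)) \<longlongrightarrow> fps_nth (inverse A) 0) F" for j
    using Suc.prems tendsto_inverse[of "\<lambda>x. f x j" _ F] by simp
  ultimately show ?case by simp
qed simp

text \<open>Multiplication by \<open>j / \<nu>\<close> gains one order of smoothness, because the limits do not
  depend on \<open>j\<close>. Since the factor vanishes at \<open>j = 0\<close>, the truncated \<open>j - 1\<close> is harmless.\<close>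
lemma smooth_upto_ramp:
  assumes "smooth_upto (Suc K) f A"
  shows "smooth_upto (Suc (Suc K)) (\<lambda>x j. real j / \<nu> x * f x (j - 1)) (fps_X * A)"
  using assms
proof (induction K arbitrary: f A)
  case (0 f A)
  have lim: "((\<lambda>x. real j / \<nu> x * f x (j - 1)) \<longlongrightarrow> 0) F" for j
    using tendsto_mult[OF tendsto_mult[OF tendsto_const[of "real j"] inverse_\<nu>_tendsto]
        smooth_upto_tendsto[OF 0]] by (simp add: divide_inverse)
  \<comment> \<open>Neighbouring values have the same limit, so the part multiplied by j
    cancels.\<close>
  have "((\<lambda>x. f x j + real j * (f x j - f x (j - 1))) \<longlongrightarrow>
      fps_nth A 0 + real j * (fps_nth A 0 - fps_nth A 0)) F" for j
    using 0 by (intro tendsto_intros) auto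
  then have "((\<lambda>x. f x j + real j * (f x j - f x (j - 1))) \<longlongrightarrow> fps_nth A 0) F" for j
    by simp
  then have "((\<lambda>x. \<nu> x * (real (Suc j) / \<nu> x * f x (Suc j - 1) - real j / \<nu> x * f x (j - 1)))
      \<longlongrightarrow> fps_nth A 0) F" for j
    by (rule Lim_transform_eventually)
       (use eventually_\<nu>_gt[of 0] in eventually_elim, simp add: field_simps)
  then show ?case using lim by simp
next
  case (Suc K f A)
  have lim: "((\<lambda>x. real j / \<nu> x * f x (j - 1)) \<longlongrightarrow> 0) F" for j
    using tendsto_mult[OF tendsto_mult[OF tendsto_const[of "real j"] inverse_\<nu>_tendsto]
        smooth_upto_tendsto[OF Suc.prems]] by (simp add: divide_inverse)
  \<comment> \<open>The rescaled difference of the ramp of \<open>f\<close> is \<open>f\<close> plus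
    the ramp of the rescaled difference of \<open>f\<close>, matching (p A)' = A + p A'.\<close>
  have "smooth_upto (Suc (Suc K))
      (\<lambda>x j. f x j + real j / \<nu> x * (\<nu> x * (f x (Suc (j - 1)) - f x (j - 1))))
      (A + fps_X * fps_deriv A)"
    by (intro smooth_upto_add Suc.prems Suc.IH smooth_upto_diff[OF Suc.prems])
  also have "A + fps_X * fps_deriv A = fps_deriv (fps_X * A)" by (simp add: add.commute)
  finally have "smooth_upto (Suc (Suc K))
      (\<lambda>x j. \<nu> x * (real (Suc j) / \<nu> x * f x (Suc j - 1) - real j / \<nu> x * f x (j - 1)))
      (fps_deriv (fps_X * A))"
  proof (rule smooth_upto_cong)
    fix j
    show "eventually (\<lambda>x. f x j + real j / \<nu> x * (\<nu> x * (f x (Suc (j - 1)) - f x (j - 1))) =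
        \<nu> x * (real (Suc j) / \<nu> x * f x (Suc j - 1) - real j / \<nu> x * f x (j - 1))) F"
      using eventually_\<nu>_gt[of 0]
      by eventually_elim (cases j; simp add: field_simps)
  qed
  then show ?case using lim by (simp only: smooth_upto.simps(2)[of "Suc (Suc K)"]) simp
qed

text \<open>Only differences of order below K are tested, and each is a fixed linear combination of
  values, multiplied by at most the power K - 1 of \<open>\<nu> x\<close>.\<close>

lemma smooth_upto_small:
  assumes "\<And>j. ((\<lambda>x. \<nu> x ^ K * f x j) \<longlongrightarrow> 0) F"
  shows "smooth_upto K f 0"
  using assms
proof (induction K arbitrary: f)
  case (Suc K)
  have "((\<lambda>x. f x j) \<longlongrightarrow> 0) F" for j
  proof -
    have "((\<lambda>x. inverse (\<nu> x) ^ Suc K * (\<nu> x ^ Suc K * f x j)) \<longlongrightarrow> 0 ^ Suc K * 0) F"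
      by (intro tendsto_mult tendsto_power inverse_\<nu>_tendsto Suc.prems)
    then have "((\<lambda>x. inverse (\<nu> x) ^ Suc K * (\<nu> x ^ Suc K * f x j)) \<longlongrightarrow> 0) F" by simp
    then show ?thesis
      by (rule Lim_transform_eventually)
         (use eventually_\<nu>_gt[of 0] in eventually_elim, simp add: power_inverse field_simps)
  qed
  moreover have "smooth_upto K (\<lambda>x j. \<nu> x * (f x (Suc j) - f x j)) 0"
  proof (rule Suc.IH)
    fix j
    have "((\<lambda>x. \<nu> x ^ Suc K * f x (Suc j) - \<nu> x ^ Suc K * f x j) \<longlongrightarrow> 0 - 0) F"
      by (intro tendsto_diff Suc.prems)
    then show "((\<lambda>x. \<nu> x ^ K * (\<nu> x * (f x (Suc j) - f x j))) \<longlongrightarrow> 0) F"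
      by (simp add: algebra_simps)
  qed
  ultimately show ?case by simp
qed simp

lemma fwd_diff_funpow_tendsto:
  assumes "smooth_upto (Suc m) f A"
  shows "((\<lambda>x. \<nu> x ^ m * (fwd_diff ^^ m) (f x) j) \<longlongrightarrow> fact m * fps_nth A m) F"
  using assms
proof (induction m arbitrary: f A)
  case (Suc m)
  have scale: "(fwd_diff ^^ m) (\<lambda>j. c * h j) j = c * (fwd_diff ^^ m) h j" for c h j
    unfolding fwd_diff_funpow by (simp add: sum_distrib_left algebra_simps)
  have "((\<lambda>x. \<nu> x ^ m * (fwd_diff ^^ m) (\<lambda>j. \<nu> x * (f x (Suc j) - f x j)) j) \<longlongrightarrow>
     fact m * fps_nth (fps_deriv A) m) F"
    by (rule Suc.IH[OF smooth_upto_diff[OF Suc.prems]])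
  moreover have "\<nu> x ^ m * (fwd_diff ^^ m) (\<lambda>j. \<nu> x * (f x (Suc j) - f x j)) j =
     \<nu> x ^ Suc m * (fwd_diff ^^ Suc m) (f x) j" for x
  proof -
    have "(fwd_diff ^^ Suc m) (f x) = (fwd_diff ^^ m) (\<lambda>j. f x (Suc j) - f x j)"
      by (simp only: funpow_Suc_right o_apply) (simp add: fwd_diff_def[abs_def])
    then show ?thesis by (simp add: scale)
  qed
  moreover have "fact m * fps_nth (fps_deriv A) m = fact (Suc m) * fps_nth A (Suc m)"
    by (simp add: algebra_simps)
  ultimately show ?case by (simp only:)
qed simp

end

section \<open>Logarithms of smooth families\<close>

text \<open>The error has derivative (-w)^(K+1) / (1 + w), which is at most 2 |z|^(K+1) in absolute
  value for |w| \<le> |z| \<le> 1/2.\<close>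

lemma ln_one_plus_taylor:
  fixes z :: real
  assumes "\<bar>z\<bar> \<le> 1/2"
  shows "\<bar>ln (1 + z) - (\<Sum>s\<le>K. (-1) ^ s / real (Suc s) * z ^ Suc s)\<bar> \<le> 2 * \<bar>z\<bar> ^ (K + 2)"
proof -
  define f where "f = (\<lambda>z::real. ln (1 + z) - (\<Sum>s\<le>K. (-1) ^ s / real (Suc s) * z ^ Suc s))"
  have deriv: "(f has_field_derivative (- w) ^ Suc K / (1 + w)) (at w within {-\<bar>z\<bar>..\<bar>z\<bar>})"
    if "w \<in> {-\<bar>z\<bar>..\<bar>z\<bar>}" for w
  proof -
    have w: "1 + w > 0" using that assms by auto
    have "(f has_field_derivative inverse (1 + w) - (\<Sum>s\<le>K. (- w) ^ s)) (at w within {-\<bar>z\<bar>..\<bar>z\<bar>})"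
      unfolding f_def using w
      by (auto intro!: derivative_eq_intros sum.cong simp del: power_Suc
            simp: power_minus[of w] divide_simps)
    moreover have "inverse (1 + w) - (\<Sum>s\<le>K. (- w) ^ s) = (- w) ^ Suc K / (1 + w)"
      using w sum_gp_basic[of "- w" K] by (simp add: field_simps)
    ultimately show ?thesis by simp
  qed
  have "norm (f z - f 0) \<le> (2 * \<bar>z\<bar> ^ Suc K) * norm (z - 0)"
  proof (rule field_differentiable_bound[OF _ deriv])
    fix w :: real assume w: "w \<in> {-\<bar>z\<bar>..\<bar>z\<bar>}"
    have "\<bar>w\<bar> ^ Suc K \<le> \<bar>z\<bar> ^ Suc K" using w by (intro power_mono) auto
    moreover have "1 + w \<ge> 1/2" using w assms by auto
    ultimately have "\<bar>w\<bar> ^ Suc K / (1 + w) \<le> \<bar>z\<bar> ^ Suc K / (1/2)"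
      by (intro frac_le) auto
    then show "norm ((- w) ^ Suc K / (1 + w)) \<le> 2 * \<bar>z\<bar> ^ Suc K"
      using w assms by (simp add: norm_divide norm_power abs_mult power_abs)
  qed auto
  then show ?thesis by (simp add: f_def power_add algebra_simps power2_eq_square)
qed

context scaling
begin

text \<open>Differences of order below K at j involve only j, ..., j + K - 1 and only the
  coefficients of \<open>A\<close> below K, so the approximant may change with the range J. This
  admits recursions whose number of terms grows with j.\<close>

lemma smooth_upto_local:
  assumes "\<And>J. \<exists>f B. smooth_upto K f B \<and> (\<forall>m<K. fps_nth B m = fps_nth A m) \<and>
      (\<forall>j\<le>J. eventually (\<lambda>x. f x j = g x j) F)"
  shows "smooth_upto K g A"
  using assms
proof (induction K arbitrary: g A)
  case (Suc K)
  have "((\<lambda>x. g x j) \<longlongrightarrow> fps_nth A 0) F" for j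
  proof -
    obtain f B where f: "smooth_upto (Suc K) f B" "fps_nth B 0 = fps_nth A 0"
      "eventually (\<lambda>x. f x j = g x j) F"
      using Suc.prems[of j] by blast
    show ?thesis
      using Lim_transform_eventually[OF smooth_upto_tendsto[OF f(1)] f(3)] f(2) by simp
  qed
  moreover have "smooth_upto K (\<lambda>x j. \<nu> x * (g x (Suc j) - g x j)) (fps_deriv A)"
  proof (rule Suc.IH)
    fix J
    obtain f B where f: "smooth_upto (Suc K) f B" "\<forall>m<Suc K. fps_nth B m = fps_nth A m"
      "\<forall>j\<le>Suc J. eventually (\<lambda>x. f x j = g x j) F"
      using Suc.prems[of "Suc J"] by blast
    have "eventually (\<lambda>x. \<nu> x * (f x (Suc j) - f x j) = \<nu> x * (g x (Suc j) - g x j)) F"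
      if "j \<le> J" for j
    proof -
      have "eventually (\<lambda>x. f x j = g x j) F" "eventually (\<lambda>x. f x (Suc j) = g x (Suc j)) F"
        using f(3) that by auto
      then show ?thesis by eventually_elim simp
    qed
    moreover have "\<forall>m<K. fps_nth (fps_deriv B) m = fps_nth (fps_deriv A) m"
      using f(2) by simp
    ultimately show "\<exists>f B. smooth_upto K f B \<and> (\<forall>m<K. fps_nth B m = fps_nth (fps_deriv A) m) \<and>
      (\<forall>j\<le>J. eventually (\<lambda>x. f x j = \<nu> x * (g x (Suc j) - g x j)) F)"
      using smooth_upto_diff[OF f(1)] by blast
  qed
  ultimately show ?case by simp
qed simp

text \<open>With \<eta> = \<nu> \<Delta>f / f the quantity is \<nu> ln(1 + \<eta>/\<nu>) = \<eta> -
  \<eta>^2 / (2 \<nu>) + ..., and every term after \<eta> carries a factor 1/\<nu>.\<close>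

lemma smooth_upto_nu_diff_ln:
  assumes f: "\<And>K. smooth_upto K f A" and pos: "fps_nth A 0 > 0"
  shows "smooth_upto K (\<lambda>x j. \<nu> x * (ln (f x (Suc j)) - ln (f x j))) (fps_deriv A * inverse A)"
proof -
  define E where "E = fps_deriv A * inverse A"
  define \<eta> where "\<eta> = (\<lambda>x j. \<nu> x * (f x (Suc j) - f x j) * inverse (f x j))"
  have \<eta>: "smooth_upto K \<eta> E" for K
    unfolding \<eta>_def E_def using pos
    by (intro smooth_upto_mult smooth_upto_diff[OF f] smooth_upto_inverse[OF f]) simp
  define P where "P = (\<lambda>x j. \<Sum>s\<le>K. ((-1) ^ s / real (Suc s) * inverse (\<nu> x) ^ s) * \<eta> x j ^ Suc s)"
  have "smooth_upto K P (\<Sum>s\<le>K. fps_const ((-1) ^ s / real (Suc s) * 0 ^ s) * E ^ Suc s)"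
    unfolding P_def
    by (intro smooth_upto_sum smooth_upto_mult smooth_upto_power[OF \<eta>] smooth_upto_const
        tendsto_intros inverse_\<nu>_tendsto)
  also have "(\<Sum>s\<le>K. fps_const ((-1) ^ s / real (Suc s) * 0 ^ s) * E ^ Suc s) =
      (\<Sum>s\<le>K. if s = 0 then E else 0)"
    by (intro sum.cong) (auto simp: power_0_left)
  also have "\<dots> = E" by simp
  finally have P: "smooth_upto K P E" .
  define R where "R = (\<lambda>x j. \<nu> x * (ln (f x (Suc j)) - ln (f x j)) - P x j)"
  \<comment> \<open>The Taylor remainder after K + 1 terms is O(\<nu>^-(K+1)), too small to be seen
    by K orders.\<close>
  have "smooth_upto K R 0"
  proof (rule smooth_upto_small)
    fix j
    have \<eta>_lim: "((\<lambda>x. \<eta> x j) \<longlongrightarrow> fps_nth E 0) F"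
      by (rule smooth_upto_tendsto[OF \<eta>])
    have "((\<lambda>x. inverse (\<nu> x) * \<eta> x j) \<longlongrightarrow> 0 * fps_nth E 0) F"
      by (intro tendsto_intros \<eta>_lim inverse_\<nu>_tendsto)
    then have "eventually (\<lambda>x. \<bar>inverse (\<nu> x) * \<eta> x j\<bar> < 1/2) F"
      by (intro order_tendstoD(2)[where y = 0]) (auto dest: tendsto_rabs_zero)
    moreover have "eventually (\<lambda>x. f x j > 0) F" "eventually (\<lambda>x. f x (Suc j) > 0) F"
      using order_tendstoD(1)[OF smooth_upto_tendsto[OF f] pos] by auto
    ultimately have "eventually (\<lambda>x. norm (\<nu> x ^ K * R x j) \<le> 2 * \<bar>\<eta> x j\<bar> ^ (K + 2) * inverse (\<nu> x)) F"
      using eventually_\<nu>_gt[of 0]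
    proof eventually_elim
      case (elim x)
      let ?z = "inverse (\<nu> x) * \<eta> x j"
      have "1 + ?z = f x (Suc j) / f x j"
        using elim by (simp add: \<eta>_def field_simps)
      then have ln: "ln (f x (Suc j)) - ln (f x j) = ln (1 + ?z)"
        using elim by (simp add: ln_div)
      have "P x j = \<nu> x * (\<Sum>s\<le>K. (-1) ^ s / real (Suc s) * ?z ^ Suc s)"
        unfolding P_def sum_distrib_left using elim
        by (intro sum.cong) (auto simp: power_mult_distrib)
      then have "R x j = \<nu> x * (ln (1 + ?z) - (\<Sum>s\<le>K. (-1) ^ s / real (Suc s) * ?z ^ Suc s))"
        unfolding R_def ln by (simp only: right_diff_distrib)
      then have "norm (\<nu> x ^ K * R x j) =
          \<nu> x ^ Suc K * \<bar>ln (1 + ?z) - (\<Sum>s\<le>K. (-1) ^ s / real (Suc s) * ?z ^ Suc s)\<bar>"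
        using elim by (simp add: abs_mult power_abs del: power_Suc) simp
      also have "\<dots> \<le> \<nu> x ^ Suc K * (2 * \<bar>?z\<bar> ^ (K + 2))"
        using elim by (intro mult_left_mono ln_one_plus_taylor) auto
      also have "\<dots> = 2 * \<bar>\<eta> x j\<bar> ^ (K + 2) * inverse (\<nu> x)"
        using elim by (simp add: abs_mult power_mult_distrib power_inverse field_simps)
      finally show ?case .
    qed
    moreover have "((\<lambda>x. 2 * \<bar>\<eta> x j\<bar> ^ (K + 2) * inverse (\<nu> x)) \<longlongrightarrow>
        2 * \<bar>fps_nth E 0\<bar> ^ (K + 2) * 0) F"
      by (intro tendsto_intros \<eta>_lim inverse_\<nu>_tendsto)
    ultimately show "((\<lambda>x. \<nu> x ^ K * R x j) \<longlongrightarrow> 0) F"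
      unfolding mult_zero_right by (rule Lim_null_comparison)
  qed
  then have "smooth_upto K (\<lambda>x j. P x j + R x j) (E + 0)"
    by (intro smooth_upto_add P)
  then show ?thesis by (simp add: R_def E_def)
qed

text \<open>If \<open>t M'(t) / M(t) = \<nu> \<cdot> \<Sum>\<^sub>s d s t\<^sup>(s+1)\<close> with \<open>X j = j! [t\<^sup>j] M(t) / \<nu>\<^sup>j\<close>, comparing
  coefficients gives the recursion below. In the limit \<open>\<nu> \<rightarrow> \<infinity>\<close>, \<open>j / \<nu> \<rightarrow> p\<close>, the ratio of consecutive
  \<open>X j\<close> becomes the series \<open>G\<close> in \<open>p\<close>.\<close>
lemma smooth_upto_ratio:
  fixes X d :: "'x \<Rightarrow> nat \<Rightarrow> real" and D G T :: "real fps"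
  assumes X0: "\<And>x. X x 0 = 1"
    and rec: "\<And>j. eventually (\<lambda>x. X x (Suc j) =
                (\<Sum>s\<le>j. d x s * X x (j - s) * (fact j / fact (j - s)) / \<nu> x ^ s)) F"
    and d: "\<And>s. ((\<lambda>x. d x s) \<longlongrightarrow> fps_nth D s) F"
    and T: "T * G = fps_X" and D: "D oo T = G" and G: "fps_nth G 0 > 0"
  shows "smooth_upto K (\<lambda>x j. X x (Suc j) / X x j) G"
    and "eventually (\<lambda>x. X x j > 0) F"
proof -
  have T0: "fps_nth T 0 = 0"
  proof -
    have "fps_nth (T * G) 0 = 0" using T by simp
    then show ?thesis using G by simp
  qed
  have D0: "fps_nth D 0 = fps_nth G 0"
    using D by (metis fps_compose_nth_0)
  \<comment> \<open>The powers of \<open>\<nu> x\<close> in the denominator kill every term but s =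
    0, so each step multiplies the limit by the constant term of \<open>G\<close>.\<close>
  have X_lim: "((\<lambda>x. X x j) \<longlongrightarrow> fps_nth G 0 ^ j) F" for j
  proof (induction j rule: less_induct)
    case (less j)
    show ?case
    proof (cases j)
      case 0
      then show ?thesis using X0 by simp
    next
      case (Suc i)
      have "((\<lambda>x. \<Sum>s\<le>i. d x s * X x (i - s) * (fact i / fact (i - s)) * inverse (\<nu> x) ^ s) \<longlongrightarrow>
         (\<Sum>s\<le>i. fps_nth D s * fps_nth G 0 ^ (i - s) * (fact i / fact (i - s)) * 0 ^ s)) F"
        using Suc by (intro tendsto_intros d less inverse_\<nu>_tendsto) auto
      also have "(\<Sum>s\<le>i. fps_nth D s * fps_nth G 0 ^ (i - s) * (fact i / fact (i - s)) * 0 ^ s) =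
          (\<Sum>s\<le>i. if s = 0 then fps_nth G 0 ^ j else 0)"
        using Suc D0 by (intro sum.cong) (auto simp: power_0_left)
      also have "\<dots> = fps_nth G 0 ^ j" by simp
      finally have "((\<lambda>x. \<Sum>s\<le>i. d x s * X x (i - s) * (fact i / fact (i - s)) * inverse (\<nu> x) ^ s)
          \<longlongrightarrow> fps_nth G 0 ^ j) F" .
      then show ?thesis
        by (rule Lim_transform_eventually)
          (use rec[of i] in eventually_elim, simp add: Suc divide_inverse power_inverse)
    qed
  qed
  have pos: "eventually (\<lambda>x. X x j > 0) F" for j
    using order_tendstoD(1)[OF X_lim[of j], of 0] G by simp
  show "eventually (\<lambda>x. X x j > 0) F" by (rule pos)

  define \<gamma> where "\<gamma> = (\<lambda>x j. X x (Suc j) / X x j)"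
  have \<gamma>_lim: "((\<lambda>x. \<gamma> x j) \<longlongrightarrow> fps_nth G 0) F" for j
    unfolding \<gamma>_def using tendsto_divide[OF X_lim[of "Suc j"] X_lim[of j]] G by simp
  \<comment> \<open>The factor of \<open>d x s\<close> after dividing the recursion by
    \<open>X x j\<close>; its limit series is \<open>T ^ s\<close>. For s > j the falling factorial
    j (j-1) ... (j-s+1) vanishes, hence the default 0.\<close>
  define Q where "Q = (\<lambda>s x j. if s \<le> j then fact j / fact (j - s) * X x (j - s) / (\<nu> x ^ s * X x j) else 0)"
  have Q0: "eventually (\<lambda>x. 1 = Q 0 x j) F" for j
    using pos[of j] by eventually_elim (simp add: Q_def)
  have Q_Suc: "eventually (\<lambda>x. real j / \<nu> x * (Q s x (j - 1) * inverse (\<gamma> x (j - 1))) = Q (Suc s) x j) F" for s j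
  proof (cases j)
    case 0
    then show ?thesis by (simp add: Q_def)
  next
    case (Suc i)
    show ?thesis
      using pos[of j] pos[of i] eventually_\<nu>_gt[of 0]
      by eventually_elim (use Suc in \<open>auto simp: Q_def \<gamma>_def field_simps\<close>)
  qed
  have T_eq: "T = fps_X * inverse G"
  proof -
    have "T * (G * inverse G) = fps_X * inverse G" using T by (simp only: mult.assoc[symmetric])
    then show ?thesis using G by (simp add: inverse_mult_eq_1')
  qed
  \<comment> \<open>Bootstrapping: \<open>Q (Suc s)\<close> is a ramp, and a ramp gains one order.
    So K + 1 orders for \<open>\<gamma>\<close> give K + 2 orders for every
    \<open>Q s\<close>.\<close>
  have Q: "smooth_upto (Suc (Suc K)) (Q s) (T ^ s)" if \<gamma>: "smooth_upto (Suc K) \<gamma> G" for K s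
  proof (induction s)
    case 0
    have "smooth_upto (Suc (Suc K)) (\<lambda>x j. 1) (fps_const 1)"
      by (rule smooth_upto_const[OF tendsto_const])
    from smooth_upto_cong[OF this Q0] show ?case by (simp only: fps_const_1_eq_1 power_0)
  next
    case (Suc s)
    have "smooth_upto (Suc (Suc K)) (\<lambda>x j. real j / \<nu> x * (Q s x (j - 1) * inverse (\<gamma> x (j - 1))))
        (fps_X * (T ^ s * inverse G))"
      using G by (intro smooth_upto_ramp smooth_upto_mult smooth_upto_SucD[OF Suc.IH]
          smooth_upto_inverse[OF \<gamma>]) simp
    from smooth_upto_cong[OF this Q_Suc]
    show ?case by (simp only: T_eq power_Suc mult_ac)
  qed
  have \<gamma>_rec: "eventually (\<lambda>x. (\<Sum>s\<le>N. d x s * Q s x j) = \<gamma> x j) F" if "j \<le> N" for j N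
    using rec[of j] pos[of j]
  proof eventually_elim
    case (elim x)
    have "(\<Sum>s\<le>N. d x s * Q s x j) = (\<Sum>s\<le>j. d x s * Q s x j)"
      using that by (intro sum.mono_neutral_right) (auto simp: Q_def)
    also have "\<dots> = \<gamma> x j"
      unfolding \<gamma>_def elim(1) sum_divide_distrib
      by (intro sum.cong) (auto simp: Q_def mult_ac)
    finally show ?case .
  qed
  have "smooth_upto (Suc K) \<gamma> G" for K
  proof (induction K)
    case 0
    show ?case using \<gamma>_lim by simp
  next
    case (Suc K)
    show ?case
    proof (rule smooth_upto_local)
      fix J
      \<comment> \<open>At least J, so that the recursion is complete for all j \<le> J; at least K
        + 1, so that the coefficients of \<open>D oo T\<close> below K + 2 are complete, as
        \<open>T ^ s\<close> starts at p^s.\<close>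
      let ?N = "max J (Suc K)"
      have "smooth_upto (Suc (Suc K)) (\<lambda>x j. \<Sum>s\<le>?N. d x s * Q s x j)
          (\<Sum>s\<le>?N. fps_const (fps_nth D s) * T ^ s)"
        by (intro smooth_upto_sum smooth_upto_mult smooth_upto_const d Q Suc.IH)
      moreover have "fps_nth (\<Sum>s\<le>?N. fps_const (fps_nth D s) * T ^ s) m = fps_nth G m"
        if "m < Suc (Suc K)" for m
      proof -
        have "fps_nth (\<Sum>s\<le>?N. fps_const (fps_nth D s) * T ^ s) m =
            (\<Sum>s\<le>?N. fps_nth D s * fps_nth (T ^ s) m)"
          by (simp add: fps_sum_nth)
        also have "\<dots> = (\<Sum>s=0..m. fps_nth D s * fps_nth (T ^ s) m)"
          using that startsby_zero_power_prefix[OF T0]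
          by (intro sum.mono_neutral_right) auto
        also have "\<dots> = fps_nth G m" by (simp add: D[symmetric] fps_compose_nth)
        finally show ?thesis .
      qed
      moreover have "\<forall>j\<le>J. eventually (\<lambda>x. (\<Sum>s\<le>?N. d x s * Q s x j) = \<gamma> x j) F"
        by (intro allI impI \<gamma>_rec) simp
      ultimately show "\<exists>f A. smooth_upto (Suc (Suc K)) f A \<and>
          (\<forall>m<Suc (Suc K). fps_nth A m = fps_nth G m) \<and>
          (\<forall>j\<le>J. eventually (\<lambda>x. f x j = \<gamma> x j) F)"
        by blast
    qed
  qed
  then show "smooth_upto K (\<lambda>x j. X x (Suc j) / X x j) G"
    unfolding \<gamma>_def by (rule smooth_upto_SucD)
qed

end

section \<open>The Bethe series of the regular tree\<close>

lemma fwd_diff_funpow_cong: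
  assumes "\<And>j. i \<le> j \<Longrightarrow> j \<le> i + k \<Longrightarrow> f j = g j"
  shows "(fwd_diff ^^ k) f i = (fwd_diff ^^ k) g i"
  unfolding fwd_diff_funpow using assms by (intro sum.cong) auto

lemma fwd_diff_funpow_mult: "(fwd_diff ^^ k) (\<lambda>j. c * f j) i = c * (fwd_diff ^^ k) f i"
  unfolding fwd_diff_funpow by (simp add: sum_distrib_left mult_ac)

context scaling
begin

text \<open>The first difference is -(ln \<nu> + ln \<gamma>); the second one loses ln \<nu> and
  equals -\<delta>/\<nu>. So the k-th difference has the sign opposite to coefficient k - 2 of
  G'/G.\<close>

lemma eventually_fwd_diff_neg_ln_pos:
  assumes smooth: "\<And>K. smooth_upto K (\<lambda>x j. X x (Suc j) / X x j) G"
    and pos: "\<And>j. eventually (\<lambda>x. X x j > 0) F"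
    and G: "fps_nth G 0 > 0" and neg: "\<And>m. fps_nth (fps_deriv G * inverse G) m < 0"
    and k: "k \<ge> 2"
  shows "eventually (\<lambda>x. (fwd_diff ^^ k) (\<lambda>j. - ln (\<nu> x ^ j * X x j)) i > 0) F"
proof -
  obtain m where m: "k = Suc (Suc m)"
    using le_Suc_ex[OF k] by auto
  define \<gamma> where "\<gamma> = (\<lambda>x j. X x (Suc j) / X x j)"
  define \<delta> where "\<delta> = (\<lambda>x j. \<nu> x * (ln (\<gamma> x (Suc j)) - ln (\<gamma> x j)))"
  have "smooth_upto (Suc m) \<delta> (fps_deriv G * inverse G)"
    unfolding \<delta>_def \<gamma>_def by (rule smooth_upto_nu_diff_ln[OF smooth G])
  from fwd_diff_funpow_tendsto[OF this, of i]
  have "eventually (\<lambda>x. \<nu> x ^ m * (fwd_diff ^^ m) (\<delta> x) i < 0) F"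
    by (rule order_tendstoD) (simp add: mult_pos_neg neg)
  moreover have "eventually (\<lambda>x. \<forall>j\<in>{..i + k}. X x j > 0) F"
    using pos by (intro eventually_ball_finite) auto
  ultimately show ?thesis
    using eventually_\<nu>_gt[of 0]
  proof eventually_elim
    case (elim x)
    let ?u = "\<lambda>j. - ln (\<nu> x ^ j * X x j)"
    have u: "fwd_diff ?u j = - (ln (\<nu> x) + ln (\<gamma> x j))" if "j < i + k" for j
    proof -
      have "X x j > 0" "X x (Suc j) > 0" using elim that by auto
      then show ?thesis
        using elim by (simp add: fwd_diff_def \<gamma>_def ln_mult ln_div ln_realpow algebra_simps)
    qed
    have "(fwd_diff ^^ k) ?u i = (fwd_diff ^^ m) (fwd_diff (fwd_diff ?u)) i"
      unfolding m funpow_Suc_right o_apply ..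
    also have "\<dots> = (fwd_diff ^^ m) (\<lambda>j. (- inverse (\<nu> x)) * \<delta> x j) i"
    proof (rule fwd_diff_funpow_cong)
      fix j assume "i \<le> j" "j \<le> i + m"
      then have "j < i + k" "Suc j < i + k" using m by auto
      then show "fwd_diff (fwd_diff ?u) j = (- inverse (\<nu> x)) * \<delta> x j"
        using u elim unfolding fwd_diff_def[of "fwd_diff ?u"] by (simp add: \<delta>_def mult.assoc[symmetric])
    qed
    also have "\<dots> = (- inverse (\<nu> x)) * (fwd_diff ^^ m) (\<delta> x) i"
      by (rule fwd_diff_funpow_mult)
    finally show ?case
      using elim by (simp add: mult_less_0_iff zero_less_mult_iff)
  qed
qed

end

section \<open>Power series identities for the regular tree\<close>

definition fps_geometric :: "real \<Rightarrow> real fps" where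
  "fps_geometric c = Abs_fps (\<lambda>m. c ^ m)"

lemma fps_geometric_mult: "fps_geometric c * (1 - fps_const c * fps_X) = 1"
proof (rule fps_ext)
  fix m
  have "fps_geometric c * (1 - fps_const c * fps_X) =
      fps_geometric c - fps_const c * (fps_X * fps_geometric c)"
    by (simp add: algebra_simps)
  then show "fps_nth (fps_geometric c * (1 - fps_const c * fps_X)) m = fps_nth 1 m"
    by (cases m) (simp_all add: fps_geometric_def)
qed

lemma fps_deriv_geometric:
  "fps_deriv (fps_geometric c) = fps_const c * fps_geometric c * fps_geometric c"
proof -
  let ?g = "fps_geometric c" and ?W = "1 - fps_const c * fps_X"
  have "fps_deriv (?g * ?W) = 0" by (simp add: fps_geometric_mult)
  then have "fps_deriv ?g * ?W = fps_const c * ?g" by (simp add: algebra_simps)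
  then have "fps_deriv ?g * (?g * ?W) = fps_const c * ?g * ?g" by (simp only: mult_ac)
  then show ?thesis by (simp add: fps_geometric_mult)
qed

text \<open>On the infinite \<open>r\<close>-regular tree, a matching covering the fraction \<open>p\<close> of the vertices of each
  part has activity \<open>t = p (1 - p/r) / (r (1 - p)\<^sup>2)\<close>; \<open>bethe r\<close> is the series \<open>p/t\<close> in \<open>p\<close>, and
  \<open>tree_density r\<close> is \<open>p\<close> as a series in \<open>t\<close>.\<close>
definition bethe :: "nat \<Rightarrow> real fps" where
  "bethe r = fps_const (real r) * (1 - fps_X)\<^sup>2 * fps_geometric (1 / real r)"

definition tree_density :: "nat \<Rightarrow> real fps" where
  "tree_density r = fps_inv (fps_X * inverse (bethe r))"

text \<open>Value of \<open>del_ratio\<close> on the infinite tree at a vertex with all r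
  neighbours; \<open>tree_branch\<close> is its value at a vertex with one neighbour
  deleted.\<close>

definition tree_root :: "nat \<Rightarrow> real fps" where
  "tree_root r = 1 - tree_density r"

definition tree_branch :: "nat \<Rightarrow> real fps" where
  "tree_branch r = (1 - tree_density r) * inverse (1 - fps_const (1 / real r) * tree_density r)"

lemma bethe_nth_0: "fps_nth (bethe r) 0 = real r"
  by (simp add: bethe_def fps_geometric_def power2_eq_square)

text \<open>For G = \<open>bethe r\<close>, G'/G = (1/r) / (1 - p/r) - 2 / (1 - p), with
  coefficients r^-(m+1) - 2.\<close>

lemma bethe_log_deriv_neg:
  assumes "r \<ge> 1"
  shows "fps_nth (fps_deriv (bethe r) * inverse (bethe r)) m < 0"
proof -
  let ?c = "1 / real r" and ?U = "1 - fps_X :: real fps"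
  let ?H = "fps_const ?c * fps_geometric ?c - 2 * fps_geometric 1"
  have 1: "fps_geometric 1 * ?U = 1" using fps_geometric_mult[of 1] by simp
  have expand: "R * V\<^sup>2 * g * (C * g - 2 * g1) = R * V\<^sup>2 * (C * g * g) - 2 * (R * V * g) * (g1 * V)"
    and collect: "R * V\<^sup>2 * (C * g * g) + (R * (- (2 * V)) + 0 * V\<^sup>2) * g = R * V\<^sup>2 * (C * g * g) - 2 * (R * V * g) * 1"
    for R V g C g1 :: "real fps"
    by (simp_all add: algebra_simps power2_eq_square)
  have square: "fps_deriv (?U\<^sup>2) = - (2 * ?U)"
    by (simp add: power2_eq_square)
  have "bethe r * ?H = fps_const (real r) * ?U\<^sup>2 * (fps_const ?c * fps_geometric ?c * fps_geometric ?c)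
      - 2 * (fps_const (real r) * ?U * fps_geometric ?c) * 1"
    unfolding bethe_def expand 1 ..
  also have "\<dots> = fps_deriv (bethe r)"
    unfolding bethe_def fps_deriv_mult fps_deriv_geometric square fps_deriv_const collect ..
  finally have "fps_deriv (bethe r) * inverse (bethe r) = ?H * (bethe r * inverse (bethe r))"
    by (simp add: mult_ac)
  also have "\<dots> = ?H"
    using assms by (simp add: inverse_mult_eq_1' bethe_nth_0)
  finally have "fps_nth (fps_deriv (bethe r) * inverse (bethe r)) m = ?c ^ Suc m - 2"
    by (simp add: fps_geometric_def numeral_fps_const)
  also have "?c ^ Suc m \<le> 1" using assms by (intro power_le_one) auto
  then have "?c ^ Suc m - 2 < 0" by simp
  finally show ?thesis .
qed

context
  fixes r :: nat
  assumes r: "r \<ge> 1"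
begin

lemma tree_density_nth_0: "fps_nth (tree_density r) 0 = 0"
  by (simp add: tree_density_def fps_inv_def)

lemma tree_density_compose:
  "tree_density r oo (fps_X * inverse (bethe r)) = fps_X"
  "(fps_X * inverse (bethe r)) oo tree_density r = fps_X"
  unfolding tree_density_def using r by (intro fps_inv fps_inv_right; simp add: bethe_nth_0)+

lemma bethe_inverse: "fps_X * inverse (bethe r) * bethe r = fps_X"
  using r by (simp add: mult.assoc inverse_mult_eq_1 bethe_nth_0)

text \<open>With P = \<open>tree_density r\<close> and T = p/G one has P(T) = p, so P(t)/t at t = T
  is p/T = G. This makes P(t)/t the series \<open>D\<close> of
  \<open>smooth_upto_ratio\<close>.\<close>

lemma tree_density_shift_compose:
  "fps_shift 1 (tree_density r) oo (fps_X * inverse (bethe r)) = bethe r"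
proof -
  let ?T = "fps_X * inverse (bethe r)"
  have "tree_density r = fps_X * fps_shift 1 (tree_density r)"
    by (rule fps_ext) (simp add: tree_density_nth_0)
  then have "fps_X = (fps_X * fps_shift 1 (tree_density r)) oo ?T"
    using tree_density_compose(1) by simp
  also have "\<dots> = ?T * (fps_shift 1 (tree_density r) oo ?T)"
    by (simp add: fps_compose_mult_distrib)
  finally have "?T * (fps_shift 1 (tree_density r) oo ?T) = ?T * bethe r"
    unfolding bethe_inverse by (rule sym)
  moreover have "?T \<noteq> 0" using bethe_inverse by force
  ultimately show ?thesis using mult_left_cancel[of ?T] by blast
qed

text \<open>This is t = P / G(P) with denominators cleared.\<close>

lemma tree_density_eq:
  "tree_density r * (1 - fps_const (1 / real r) * tree_density r) =
    fps_const (real r) * fps_X * (1 - tree_density r)\<^sup>2"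
proof -
  let ?P = "tree_density r"
  have P0: "fps_nth ?P 0 = 0" by (rule tree_density_nth_0)
  have "(fps_X * inverse (bethe r) * bethe r) oo ?P = fps_X oo ?P"
    by (simp only: bethe_inverse)
  then have 1: "fps_X * (bethe r oo ?P) = ?P"
    unfolding fps_compose_mult_distrib[OF P0, of "fps_X * inverse (bethe r)"] tree_density_compose
    by (simp add: P0)
  have "bethe r * (1 - fps_const (1 / real r) * fps_X) = fps_const (real r) * (1 - fps_X)\<^sup>2"
    unfolding bethe_def mult.assoc fps_geometric_mult by simp
  then have "(bethe r * (1 - fps_const (1 / real r) * fps_X)) oo ?P = (fps_const (real r) * (1 - fps_X)\<^sup>2) oo ?P"
    by simp
  then have 2: "(bethe r oo ?P) * (1 - fps_const (1 / real r) * ?P) = fps_const (real r) * (1 - ?P)\<^sup>2"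
    by (simp add: fps_compose_mult_distrib[OF P0] fps_compose_sub_distrib power2_eq_square P0)
  have "?P * (1 - fps_const (1 / real r) * ?P) = fps_X * ((bethe r oo ?P) * (1 - fps_const (1 / real r) * ?P))"
    using 1 by (simp only: mult.assoc[symmetric])
  then show ?thesis unfolding 2 by (simp only: mult_ac)
qed

text \<open>What \<open>del_ratio_rec\<close> becomes on the tree: below the root every vertex has r
  - 1 neighbours left. Both equations reduce to \<open>tree_density_eq\<close>.\<close>

lemma tree_recursion:
  "tree_branch r * (1 + fps_X * (of_nat (r - 1) * tree_branch r)) = 1"
  "tree_root r * (1 + fps_X * (of_nat r * tree_branch r)) = 1"
proof -
  define P where "P = tree_density r"
  define W where "W = 1 - fps_const (1 / real r) * P"
  define V where "V = inverse W"
  have WV: "W * V = 1"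
    unfolding V_def by (rule inverse_mult_eq_1') (simp add: W_def P_def tree_density_nth_0)
  have branch: "tree_branch r = (1 - P) * V" and root: "tree_root r = 1 - P"
    by (simp_all add: tree_branch_def tree_root_def P_def W_def V_def)
  have r_eq: "of_nat r = fps_const (real r)" by (simp add: fps_of_nat)
  have eq: "of_nat r * fps_X * (1 - P)\<^sup>2 = P * W"
    using tree_density_eq unfolding P_def W_def r_eq by simp
  have rc: "fps_const (1 / real r) * of_nat r = 1"
    using r by (simp add: r_eq)
  have r1: "(of_nat (r - 1) :: real fps) = of_nat r - 1" using r by (simp add: of_nat_diff)
  have "fps_X * (1 - P)\<^sup>2 = fps_const (1 / real r) * (of_nat r * fps_X * (1 - P)\<^sup>2)"
    by (simp only: mult.assoc[symmetric] rc mult_1_left)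
  then have eq': "fps_X * (1 - P)\<^sup>2 = fps_const (1 / real r) * P * W"
    unfolding eq by (simp only: mult.assoc)
  have "tree_root r * (1 + fps_X * (of_nat r * tree_branch r)) =
      (1 - P) + (of_nat r * fps_X * (1 - P)\<^sup>2) * V"
    unfolding branch root by (simp add: algebra_simps power2_eq_square)
  also have "\<dots> = 1 - P + P * (W * V)" unfolding eq by (simp only: mult.assoc)
  finally show "tree_root r * (1 + fps_X * (of_nat r * tree_branch r)) = 1" by (simp add: WV)
  have "tree_branch r * (1 + fps_X * (of_nat (r - 1) * tree_branch r)) =
      (1 - P) * V * (W * V) + (of_nat r * fps_X * (1 - P)\<^sup>2 - fps_X * (1 - P)\<^sup>2) * V * V"
    unfolding branch r1 WV by (simp add: algebra_simps power2_eq_square)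
  also have "\<dots> = (1 - P + P - fps_const (1 / real r) * P) * (W * V) * V"
    unfolding eq eq' by (simp add: algebra_simps)
  also have "\<dots> = W * V" unfolding WV using WV by (simp add: W_def)
  finally show "tree_branch r * (1 + fps_X * (of_nat (r - 1) * tree_branch r)) = 1" by (simp add: WV)
qed

end

section \<open>Matching generating functions\<close>

definition matching_fps :: "'a set set \<Rightarrow> real fps" where
  "matching_fps E = Abs_fps (\<lambda>j. real (num_matchings E j))"

text \<open>Graphs are bare edge sets, so a deleted vertex stays as an isolated point, invisible to
  matchings.\<close>

definition del_vertex :: "'a set set \<Rightarrow> 'a \<Rightarrow> 'a set set" where
  "del_vertex E v = {e \<in> E. v \<notin> e}"

definition neighbours :: "'a set set \<Rightarrow> 'a \<Rightarrow> 'a set" where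
  "neighbours E v = {u. {v, u} \<in> E}"

definition simple_edges :: "'a set set \<Rightarrow> bool" where
  "simple_edges E \<longleftrightarrow> finite E \<and> (\<forall>e\<in>E. card e = 2)"

lemma simple_edges_subset: "simple_edges E \<Longrightarrow> E' \<subseteq> E \<Longrightarrow> simple_edges E'"
  by (auto simp: simple_edges_def intro: finite_subset)

lemma simple_edges_del_vertex: "simple_edges E \<Longrightarrow> simple_edges (del_vertex E v)"
  by (rule simple_edges_subset) (auto simp: del_vertex_def)

lemma not_neighbour_self: "simple_edges E \<Longrightarrow> v \<notin> neighbours E v"
  by (auto simp: simple_edges_def neighbours_def)

lemma incident_edges_eq:
  assumes "simple_edges E"
  shows "{e \<in> E. v \<in> e} = (\<lambda>u. {v, u}) ` neighbours E v"
proof -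
  have "e \<in> (\<lambda>u. {v, u}) ` neighbours E v" if "e \<in> E" "v \<in> e" for e
  proof -
    have "card e = 2" using assms that by (auto simp: simple_edges_def)
    then obtain x y where "e = {x, y}" by (auto simp: card_2_iff)
    then have "e = {v, if v = x then y else x}" using that by auto
    then show ?thesis using that unfolding neighbours_def by blast
  qed
  then show ?thesis by (auto simp: neighbours_def)
qed

lemma inj_on_incident: "simple_edges E \<Longrightarrow> inj_on (\<lambda>u. {v, u}) (neighbours E v)"
  using not_neighbour_self[of E v] by (auto simp: inj_on_def doubleton_eq_iff)

lemma finite_neighbours: "simple_edges E \<Longrightarrow> finite (neighbours E v)"
proof -
  assume E: "simple_edges E"
  then have "finite {e \<in> E. v \<in> e}" by (simp add: simple_edges_def)
  then show ?thesis
    unfolding incident_edges_eq[OF E] by (rule finite_imageD[OF _ inj_on_incident[OF E]])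
qed

lemma card_neighbours: "simple_edges E \<Longrightarrow> card (neighbours E v) = vertex_degree E v"
  unfolding vertex_degree_def incident_edges_eq by (simp add: card_image inj_on_incident)

lemma neighbours_mono: "E' \<subseteq> E \<Longrightarrow> neighbours E' v \<subseteq> neighbours E v"
  by (auto simp: neighbours_def)

lemma finite_matchings: "finite E \<Longrightarrow> finite (matchings E j)"
  unfolding matchings_def by (rule finite_subset[of _ "Pow E"]) auto

text \<open>A matching either avoids \<open>v\<close> or has exactly one edge \<open>e\<close> at
  \<open>v\<close>; removing \<open>e\<close> leaves a matching among the edges disjoint from
  \<open>e\<close>.\<close>

lemma num_matchings_Suc:
  assumes "finite E"
  shows "num_matchings E (Suc j) = num_matchings (del_vertex E v) (Suc j) +
    (\<Sum>e\<in>{e \<in> E. v \<in> e}. num_matchings {f \<in> E. f \<inter> e = {}} j)"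
proof -
  let ?S = "{e \<in> E. v \<in> e}" and ?rest = "\<lambda>e. matchings {f \<in> E. f \<inter> e = {}} j"
  have split: "matchings E (Suc j) = matchings (del_vertex E v) (Suc j) \<union> (\<Union>e\<in>?S. insert e ` ?rest e)"
  proof (intro equalityI subsetI)
    fix M assume M: "M \<in> matchings E (Suc j)"
    show "M \<in> matchings (del_vertex E v) (Suc j) \<union> (\<Union>e\<in>?S. insert e ` ?rest e)"
    proof (cases "\<exists>e\<in>M. v \<in> e")
      case True
      then obtain e where e: "e \<in> M" "v \<in> e" by blast
      have "M - {e} \<in> ?rest e"
        using M e by (auto simp: matchings_def pairwise_def disjnt_def)
      moreover have "M = insert e (M - {e})" using e by blast
      ultimately have "M \<in> insert e ` ?rest e" by blast
      moreover have "e \<in> ?S" using M e by (auto simp: matchings_def)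
      ultimately show ?thesis by blast
    next
      case False
      then show ?thesis using M by (auto simp: matchings_def del_vertex_def)
    qed
  next
    fix M assume "M \<in> matchings (del_vertex E v) (Suc j) \<union> (\<Union>e\<in>?S. insert e ` ?rest e)"
    then show "M \<in> matchings E (Suc j)"
    proof
      assume "M \<in> matchings (del_vertex E v) (Suc j)"
      then show ?thesis by (auto simp: matchings_def del_vertex_def)
    next
      assume "M \<in> (\<Union>e\<in>?S. insert e ` ?rest e)"
      then obtain e N where e: "e \<in> E" "v \<in> e" and N: "N \<in> ?rest e" and M: "M = insert e N" by blast
      have "e \<notin> N" using e N by (auto simp: matchings_def)
      then show ?thesis
        using e N M by (auto simp: matchings_def pairwise_insert disjnt_def)
    qed
  qed
  have "card (insert e ` ?rest e) = card (?rest e)" if "e \<in> ?S" for e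
  proof (intro card_image inj_onI)
    fix M N assume MN: "M \<in> ?rest e" "N \<in> ?rest e" and eq: "insert e M = insert e N"
    have "e \<notin> M" "e \<notin> N" using that MN by (auto simp: matchings_def)
    then show "M = N" using eq by (metis insert_ident)
  qed
  moreover have "card (\<Union>e\<in>?S. insert e ` ?rest e) = (\<Sum>e\<in>?S. card (insert e ` ?rest e))"
  proof (rule card_UN_disjoint)
    show "\<forall>e\<in>?S. \<forall>f\<in>?S. e \<noteq> f \<longrightarrow> insert e ` ?rest e \<inter> insert f ` ?rest f = {}"
    proof (intro ballI impI equals0I)
      fix e f M assume ef: "e \<in> ?S" "f \<in> ?S" "e \<noteq> f" and M: "M \<in> insert e ` ?rest e \<inter> insert f ` ?rest f"
      then obtain N where "N \<in> ?rest e" "M = insert e N" by blast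
      moreover have "f \<in> M" using M by blast
      ultimately have "f \<inter> e = {}" using ef by (auto simp: matchings_def)
      then show False using ef by blast
    qed
  qed (use assms in \<open>auto intro!: finite_imageI finite_matchings\<close>)
  moreover have "card (matchings E (Suc j)) = card (matchings (del_vertex E v) (Suc j)) +
      card (\<Union>e\<in>?S. insert e ` ?rest e)"
    unfolding split
  proof (rule card_Un_disjoint)
    show "matchings (del_vertex E v) (Suc j) \<inter> (\<Union>e\<in>?S. insert e ` ?rest e) = {}"
      by (auto simp: matchings_def del_vertex_def)
  qed (use assms in \<open>auto simp: del_vertex_def intro!: finite_imageI finite_matchings\<close>)
  ultimately show ?thesis by (simp add: num_matchings_def)
qed

lemma matching_fps_rec:
  assumes "simple_edges E"
  shows "matching_fps E = matching_fps (del_vertex E v) +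
    fps_X * (\<Sum>u\<in>neighbours E v. matching_fps (del_vertex (del_vertex E v) u))"
proof (rule fps_ext)
  fix m
  have fin: "finite E" using assms by (simp add: simple_edges_def)
  show "fps_nth (matching_fps E) m = fps_nth (matching_fps (del_vertex E v) +
    fps_X * (\<Sum>u\<in>neighbours E v. matching_fps (del_vertex (del_vertex E v) u))) m"
  proof (cases m)
    case 0
    then show ?thesis by (simp add: matching_fps_def num_matchings_0)
  next
    case (Suc j)
    have "{f \<in> E. f \<inter> {v, u} = {}} = del_vertex (del_vertex E v) u" for u
      by (auto simp: del_vertex_def)
    then have "(\<Sum>e\<in>{e \<in> E. v \<in> e}. num_matchings {f \<in> E. f \<inter> e = {}} j) =
        (\<Sum>u\<in>neighbours E v. num_matchings (del_vertex (del_vertex E v) u) j)"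
      unfolding incident_edges_eq[OF assms]
      by (subst sum.reindex[OF inj_on_incident[OF assms]]) simp
    then show ?thesis
      using Suc num_matchings_Suc[OF fin, of j v] by (simp add: matching_fps_def fps_sum_nth)
  qed
qed

text \<open>Double counting of pairs of a vertex in \<open>S\<close> and a matching covering it:
  every edge has one end in \<open>S\<close>, so a j-matching covers j vertices of \<open>S\<close>.
  Coefficientwise this expresses t M'(t) through vertex deletions.\<close>

lemma sum_num_matchings_del_vertex:
  assumes "finite E" "finite S" and S: "\<And>e. e \<in> E \<Longrightarrow> card (e \<inter> S) = 1"
  shows "(\<Sum>v\<in>S. num_matchings (del_vertex E v) j) + j * num_matchings E j = card S * num_matchings E j"
proof -
  let ?M = "matchings E j"
  have fin: "finite ?M" using assms by (intro finite_matchings)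
  have cov: "card {v \<in> S. v \<in> \<Union>M} = j" if M: "M \<in> ?M" for M
  proof -
    have "{v \<in> S. v \<in> \<Union>M} = (\<Union>e\<in>M. e \<inter> S)" by auto
    also have "card \<dots> = (\<Sum>e\<in>M. card (e \<inter> S))"
      using M assms(2) by (intro card_UN_disjoint) (auto simp: matchings_def pairwise_def disjnt_def)
    also have "\<dots> = (\<Sum>e\<in>M. 1)"
      using M S by (intro sum.cong) (auto simp: matchings_def)
    also have "\<dots> = j" using M by (simp add: matchings_def)
    finally show ?thesis .
  qed
  have split: "num_matchings E j = num_matchings (del_vertex E v) j + card {M \<in> ?M. v \<in> \<Union>M}" for v
  proof -
    have "?M = matchings (del_vertex E v) j \<union> {M \<in> ?M. v \<in> \<Union>M}"
      by (auto simp: matchings_def del_vertex_def)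
    also have "card \<dots> = card (matchings (del_vertex E v) j) + card {M \<in> ?M. v \<in> \<Union>M}"
      using assms fin by (intro card_Un_disjoint finite_matchings) (auto simp: matchings_def del_vertex_def)
    finally show ?thesis by (simp add: num_matchings_def)
  qed
  have "card S * num_matchings E j = (\<Sum>v\<in>S. num_matchings E j)" by simp
  also have "\<dots> = (\<Sum>v\<in>S. num_matchings (del_vertex E v) j) + (\<Sum>v\<in>S. card {M \<in> ?M. v \<in> \<Union>M})"
    unfolding sum.distrib[symmetric] by (intro sum.cong refl split)
  also have "(\<Sum>v\<in>S. card {M \<in> ?M. v \<in> \<Union>M}) = (\<Sum>M\<in>?M. card {v \<in> S. v \<in> \<Union>M})"
    by (rule sum_multicount_gen[symmetric, where k = "\<lambda>v. card {M \<in> ?M. v \<in> \<Union>M}"]) (use assms fin in auto)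
  also have "\<dots> = j * num_matchings E j" using cov by (simp add: num_matchings_def)
  finally show ?thesis by simp
qed

section \<open>Vertex deletion ratios and their tree values\<close>

text \<open>Formally the probability that \<open>v\<close> is unmatched when a j-matching has weight
  t^j.\<close>

definition del_ratio :: "'a set set \<Rightarrow> 'a \<Rightarrow> real fps" where
  "del_ratio E v = matching_fps (del_vertex E v) * inverse (matching_fps E)"

lemma matching_fps_nth_0: "fps_nth (matching_fps E) 0 = 1"
  by (simp add: matching_fps_def num_matchings_0)

lemma matching_fps_inverse: "matching_fps E * inverse (matching_fps E) = 1"
  by (rule inverse_mult_eq_1') (simp add: matching_fps_nth_0)

text \<open>The deletion recurrence divided by the generating function of the graph without
  \<open>v\<close>.\<close>

lemma del_ratio_rec:
  assumes "simple_edges E"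
  shows "del_ratio E v * (1 + fps_X * (\<Sum>u\<in>neighbours E v. del_ratio (del_vertex E v) u)) = 1"
proof -
  let ?M = "matching_fps (del_vertex E v)"
  have "?M * (1 + fps_X * (\<Sum>u\<in>neighbours E v. del_ratio (del_vertex E v) u)) =
      ?M + fps_X * (\<Sum>u\<in>neighbours E v. matching_fps (del_vertex (del_vertex E v) u)) * (?M * inverse ?M)"
    by (simp add: del_ratio_def sum_distrib_left sum_distrib_right algebra_simps)
  also have "\<dots> = matching_fps E"
    using matching_fps_rec[OF assms, of v] by (simp add: matching_fps_inverse)
  finally have "?M * (1 + fps_X * (\<Sum>u\<in>neighbours E v. del_ratio (del_vertex E v) u)) = matching_fps E" .
  then show ?thesis
    unfolding del_ratio_def[of E v] using matching_fps_inverse[of E] by (simp only: mult_ac)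
qed

lemma fps_reciprocal_nth:
  fixes A B :: "'a :: comm_ring_1 fps"
  assumes "A * (1 + fps_X * B) = 1"
  shows "fps_nth A 0 = 1" "fps_nth A (Suc m) = - (\<Sum>i=0..m. fps_nth A i * fps_nth B (m - i))"
proof -
  have A: "A = 1 - fps_X * (A * B)" using assms by (simp add: algebra_simps)
  show "fps_nth A 0 = 1" by (subst A) simp
  show "fps_nth A (Suc m) = - (\<Sum>i=0..m. fps_nth A i * fps_nth B (m - i))"
  proof -
    have "fps_nth A (Suc m) = - fps_nth (A * B) m" by (subst A) simp
    then show ?thesis by (simp add: fps_mult_nth)
  qed
qed

text \<open>As A = 1 - t A B, coefficient m + 1 of \<open>A\<close> depends only on coefficients up
  to m of \<open>A\<close> and \<open>B\<close>; the factor t gains one order.\<close>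

lemma fps_reciprocal_agree:
  fixes A B :: "'a :: comm_ring_1 fps"
  assumes "A * (1 + fps_X * B) = 1" "A' * (1 + fps_X * B') = 1"
    and "\<And>m. m \<le> s \<Longrightarrow> fps_nth B m = fps_nth B' m"
  shows "m \<le> Suc s \<Longrightarrow> fps_nth A m = fps_nth A' m"
proof (induction m rule: less_induct)
  case (less m)
  show ?case
  proof (cases m)
    case 0
    then show ?thesis using fps_reciprocal_nth(1) assms by metis
  next
    case (Suc l)
    then show ?thesis
      unfolding Suc fps_reciprocal_nth(2)[OF assms(1)] fps_reciprocal_nth(2)[OF assms(2)]
      using less assms(3) \<open>m = Suc l\<close> by (intro arg_cong[of _ _ uminus] sum.cong arg_cong2[of _ _ _ _ "(*)"]) auto
  qed
qed

text \<open>Deleting \<open>v\<close> before moving to its neighbours mirrors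
  \<open>del_ratio_rec\<close>. Self-avoiding walks from \<open>v\<close> must branch as in a tree
  with d children at the root and r - 1 afterwards; a cycle shows up as a missing neighbour where a
  walk would close it.\<close>

primrec tree_like :: "nat \<Rightarrow> nat \<Rightarrow> nat \<Rightarrow> 'a set set \<Rightarrow> 'a \<Rightarrow> bool" where
  "tree_like r 0 d E v = True"
| "tree_like r (Suc s) d E v =
    (card (neighbours E v) = d \<and> (\<forall>u\<in>neighbours E v. tree_like r s (r - 1) (del_vertex E v) u))"

lemma tree_like_SucD: "tree_like r (Suc s) d E v \<Longrightarrow> tree_like r s d E v"
proof (induction s arbitrary: d E v)
  case (Suc s)
  then show ?case unfolding tree_like.simps(2)[of r s] tree_like.simps(2)[of r "Suc s"] by blast
qed simp

lemma tree_like_antimono: "s \<le> s' \<Longrightarrow> tree_like r s' d E v \<Longrightarrow> tree_like r s d E v"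
proof (induction rule: inc_induct)
  case (step s)
  show ?case by (rule tree_like_SucD[OF step.IH[OF step.prems]])
qed

text \<open>Down to depth s the ratio obeys the recursion of the tree, and each level settles one
  more coefficient. \<open>A\<close> and \<open>B\<close> stand for the root and branch
  series.\<close>

lemma del_ratio_tree_like:
  assumes "simple_edges E" "tree_like r s d E v"
    and B: "B * (1 + fps_X * (of_nat (r - 1) * B)) = 1"
    and A: "A * (1 + fps_X * (of_nat d * B)) = 1"
    and "m \<le> s"
  shows "fps_nth (del_ratio E v) m = fps_nth A m"
  using assms(1,2,4,5)
proof (induction s arbitrary: E d v A m)
  case 0
  then show ?case
    using fps_reciprocal_nth(1)[OF del_ratio_rec] fps_reciprocal_nth(1) by (metis le_zero_eq)
next
  case (Suc s)
  show ?case
  proof (rule fps_reciprocal_agree[OF del_ratio_rec[OF Suc.prems(1)] Suc.prems(3) _ Suc.prems(4)])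
    fix m assume m: "m \<le> s"
    have "fps_nth (\<Sum>u\<in>neighbours E v. del_ratio (del_vertex E v) u) m =
        (\<Sum>u\<in>neighbours E v. fps_nth B m)"
      unfolding fps_sum_nth
      using Suc.prems m by (intro sum.cong Suc.IH[OF _ _ B] simple_edges_del_vertex) auto
    also have "\<dots> = fps_nth (of_nat d * B) m"
      using Suc.prems by (simp add: fps_of_nat[symmetric])
    finally show "fps_nth (\<Sum>u\<in>neighbours E v. del_ratio (del_vertex E v) u) m = fps_nth (of_nat d * B) m" .
  qed
qed

text \<open>Each coefficient is a sum of products of lower ones, of this graph and of vertex-deleted
  graphs, and deletion does not raise degrees. This controls the vertices that are not
  tree-like.\<close>

lemma del_ratio_bounded:
  "\<exists>C. \<forall>(E::'a set set) v. simple_edges E \<longrightarrow> (\<forall>w. card (neighbours E w) \<le> r) \<longrightarrow>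
     (\<forall>l\<le>m. \<bar>fps_nth (del_ratio E v) l\<bar> \<le> C)"
proof (induction m)
  case 0
  have "\<bar>fps_nth (del_ratio E v) 0\<bar> \<le> 1" if "simple_edges E" for E :: "'a set set" and v
    using fps_reciprocal_nth(1)[OF del_ratio_rec[OF that]] by simp
  then show ?case by (intro exI[of _ 1]) auto
next
  case (Suc m)
  then obtain C where C: "\<And>E v l. simple_edges (E::'a set set) \<Longrightarrow> (\<And>w. card (neighbours E w) \<le> r) \<Longrightarrow>
     l \<le> m \<Longrightarrow> \<bar>fps_nth (del_ratio E v) l\<bar> \<le> C"
    by blast
  let ?C = "\<bar>C\<bar>" and ?D = "real (Suc m) * (\<bar>C\<bar> * (real r * \<bar>C\<bar>))"
  have "\<bar>fps_nth (del_ratio E v) l\<bar> \<le> max ?C ?D"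
    if E: "simple_edges (E::'a set set)" "\<And>w. card (neighbours E w) \<le> r" and l: "l \<le> Suc m" for E v l
  proof (cases "l = Suc m")
    case False
    then have "\<bar>fps_nth (del_ratio E v) l\<bar> \<le> C" using l by (intro C E) auto
    then show ?thesis by linarith
  next
    case True
    let ?S = "\<Sum>u\<in>neighbours E v. del_ratio (del_vertex E v) u"
    have del: "card (neighbours (del_vertex E v) w) \<le> r" for w
      using card_mono[OF finite_neighbours[OF E(1), of w] neighbours_mono[of "del_vertex E v" E w]] E(2)[of w]
      by (auto simp: del_vertex_def)
    have S: "\<bar>fps_nth ?S i\<bar> \<le> real r * \<bar>C\<bar>" if "i \<le> m" for i
    proof -
      have "\<bar>fps_nth ?S i\<bar> \<le> (\<Sum>u\<in>neighbours E v. \<bar>fps_nth (del_ratio (del_vertex E v) u) i\<bar>)"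
        unfolding fps_sum_nth by (rule sum_abs)
      also have "\<dots> \<le> (\<Sum>u\<in>neighbours E v. \<bar>C\<bar>)"
        using that by (intro sum_mono order_trans[OF C abs_ge_self] simple_edges_del_vertex E del)
      also have "\<dots> \<le> real r * \<bar>C\<bar>" using E(2)[of v] by (simp add: mult_right_mono)
      finally show ?thesis .
    qed
    have "\<bar>fps_nth (del_ratio E v) (Suc m)\<bar> \<le>
        (\<Sum>i=0..m. \<bar>fps_nth (del_ratio E v) i * fps_nth ?S (m - i)\<bar>)"
      unfolding fps_reciprocal_nth(2)[OF del_ratio_rec[OF E(1)]] abs_minus_cancel by (rule sum_abs)
    also have "\<dots> \<le> (\<Sum>i=0..m. \<bar>C\<bar> * (real r * \<bar>C\<bar>))"
      unfolding abs_mult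
      by (intro sum_mono mult_mono S order_trans[OF C abs_ge_self] E) auto
    also have "\<dots> = ?D" by simp
    finally show ?thesis using True by simp
  qed
  then show ?case by blast
qed

section \<open>Switching away short cycles\<close>

fun path_edges :: "'a list \<Rightarrow> 'a set set" where
  "path_edges (u # v # xs) = insert {u, v} (path_edges (v # xs))"
| "path_edges _ = {}"

lemma path_edges_Cons: "p \<noteq> [] \<Longrightarrow> path_edges (u # p) = insert {u, hd p} (path_edges p)"
  by (cases p) auto

lemma path_edges_subset: "e \<in> path_edges p \<Longrightarrow> e \<subseteq> set p"
  by (induction p rule: path_edges.induct) auto

text \<open>A lasso \<open>q\<close> is a path, listed from its tip \<open>q ! 0\<close> to its start, together with an edge from the tip
  back to \<open>q ! a\<close>; for \<open>a \<ge> 2\<close> this edge closes a cycle.\<close>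
definition lassos :: "'a set \<Rightarrow> 'a set set \<Rightarrow> nat \<Rightarrow> nat \<Rightarrow> 'a list set" where
  "lassos V E l a = {q. length q = Suc l \<and> last q \<in> V \<and> distinct q \<and> path_edges q \<subseteq> E \<and> {q ! 0, q ! a} \<in> E}"

text \<open>What survives of a lasso once its closing edge is switched away.\<close>

definition walks :: "'a set \<Rightarrow> 'a set set \<Rightarrow> nat \<Rightarrow> 'a list set" where
  "walks V E l = {q. length q = Suc l \<and> last q \<in> V \<and> path_edges q \<subseteq> E}"

lemma lassos_subset_walks: "lassos V E l a \<subseteq> walks V E l"
  by (auto simp: lassos_def walks_def)

lemma card_walks:
  assumes "finite V" "simple_edges E" and deg: "\<And>v. card (neighbours E v) \<le> r"
  shows "finite (walks V E l) \<and> card (walks V E l) \<le> card V * r ^ l"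
proof (induction l)
  case 0
  have "walks V E 0 \<subseteq> (\<lambda>v. [v]) ` V" by (auto simp: walks_def length_Suc_conv)
  then show ?case
    using finite_surj[OF assms(1)] surj_card_le[OF assms(1)] by auto
next
  case (Suc l)
  have sub: "walks V E (Suc l) \<subseteq> (\<Union>q\<in>walks V E l. (\<lambda>u. u # q) ` neighbours E (hd q))" (is "_ \<subseteq> ?R")
  proof
    fix q assume q: "q \<in> walks V E (Suc l)"
    then obtain u p where p: "q = u # p" "length p = Suc l" by (auto simp: walks_def length_Suc_conv)
    then have ne: "p \<noteq> []" by auto
    have "p \<in> walks V E l" "{u, hd p} \<in> E"
      using q p ne by (auto simp: walks_def path_edges_Cons)
    then have "p \<in> walks V E l" "u \<in> neighbours E (hd p)"
      by (auto simp: neighbours_def insert_commute)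
    then show "q \<in> ?R" using p by blast
  qed
  have fin: "finite ?R"
    using Suc finite_neighbours[OF assms(2)] by (intro finite_UN_I finite_imageI) auto
  have "card ?R \<le> (\<Sum>q\<in>walks V E l. card ((\<lambda>u. u # q) ` neighbours E (hd q)))"
    using Suc by (intro card_UN_le) auto
  also have "\<dots> \<le> (\<Sum>q\<in>walks V E l. r)"
    by (intro sum_mono order_trans[OF card_image_le[OF finite_neighbours[OF assms(2)]] deg])
  also have "\<dots> \<le> card V * r ^ l * r" using Suc by simp
  finally have "card ?R \<le> card V * r ^ Suc l" by (simp add: mult_ac)
  then show ?case using finite_subset[OF sub fin] card_mono[OF fin sub] by linarith
qed

text \<open>\<open>p\<close> is the path explored so far, with tip \<open>hd p\<close>. If the tip
  has the wrong number of neighbours left, it is joined to a path vertex other than its predecessor,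
  closing a lasso. Otherwise some child fails, and the path is extended to it.\<close>

lemma not_tree_like_lasso:
  assumes E: "simple_edges E" and V: "\<Union>E \<subseteq> V" and reg: "\<And>v. v \<in> V \<Longrightarrow> card (neighbours E v) = r"
  assumes "\<not> tree_like r s (if tl p = [] then r else r - 1) {e \<in> E. e \<inter> set (tl p) = {}} (hd p)"
    and "p \<noteq> []" "distinct p" "path_edges p \<subseteq> E" "hd p \<in> V"
  shows "\<exists>q a. 2 \<le> a \<and> a < length q \<and> length q \<le> length p + s \<and> last q = last p \<and> distinct q \<and>
    path_edges q \<subseteq> E \<and> {q ! 0, q ! a} \<in> E"
  using assms(4-8)
proof (induction s arbitrary: p)
  case (Suc s)
  obtain v ps where p: "p = v # ps" using Suc.prems(2) by (cases p) auto
  let ?E = "{e \<in> E. e \<inter> set ps = {}}"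
  show ?case
  proof (cases "card (neighbours ?E v) = (if ps = [] then r else r - 1)")
    case True
    then obtain u where u: "u \<in> neighbours ?E v" and nt: "\<not> tree_like r s (r - 1) (del_vertex ?E v) u"
      using Suc.prems(1) p by auto
    have vu: "{v, u} \<in> E" "u \<notin> set ps" using u by (auto simp: neighbours_def)
    have "u \<noteq> v" using not_neighbour_self[OF E, of v] vu by (auto simp: neighbours_def)
    have "del_vertex ?E v = {e \<in> E. e \<inter> set p = {}}" by (auto simp: del_vertex_def p)
    then have "\<exists>q a. 2 \<le> a \<and> a < length q \<and> length q \<le> length (u # p) + s \<and> last q = last (u # p) \<and>
        distinct q \<and> path_edges q \<subseteq> E \<and> {q ! 0, q ! a} \<in> E"
      using nt Suc.prems vu \<open>u \<noteq> v\<close> V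
      by (intro Suc.IH) (auto simp: p insert_commute)
    then show ?thesis using Suc.prems(2) by (auto simp: p)
  next
    case False
    have "ps \<noteq> []" using False reg[of v] Suc.prems(5) p by auto
    then obtain w qs where ps: "ps = w # qs" by (cases ps) auto
    have wv: "w \<in> neighbours E v" using Suc.prems(4) by (auto simp: p ps neighbours_def)
    have nb: "neighbours ?E v = neighbours E v - set ps"
      using Suc.prems(3) by (auto simp: neighbours_def p)
    \<comment> \<open>Were the predecessor \<open>w\<close> the only neighbour on the path, exactly
      r - 1 neighbours would remain.\<close>
    have "\<exists>y\<in>set qs. {v, y} \<in> E"
    proof (rule ccontr)
      assume "\<not> ?thesis"
      then have "neighbours ?E v = neighbours E v - {w}"
        unfolding nb by (auto simp: ps neighbours_def)
      then have "card (neighbours ?E v) = r - 1"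
        using wv finite_neighbours[OF E] reg[of v] Suc.prems(5) p by simp
      then show False using False \<open>ps \<noteq> []\<close> by simp
    qed
    then obtain i where i: "i < length qs" "{v, qs ! i} \<in> E" by (auto simp: in_set_conv_nth)
    \<comment> \<open>\<open>qs ! i\<close> is entry i + 2 of \<open>p = v # w # qs\<close>.\<close>
    show ?thesis
      by (rule exI[of _ p], rule exI[of _ "i + 2"]) (use i Suc.prems in \<open>auto simp: p ps\<close>)
  qed
qed simp

section \<open>Switchings and the number of lassos\<close>

text \<open>Either pair is disjoint and both have the same union, so each vertex of it lies on
  exactly one edge of each pair.\<close>

lemma vertex_degree_switch:
  assumes "finite E" "c \<in> E" "f \<in> E" "c \<noteq> f" "c \<inter> f = {}"
    and "c' \<notin> E" "f' \<notin> E" "c' \<noteq> f'" "c' \<inter> f' = {}" "c \<union> f = c' \<union> f'"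
  shows "vertex_degree (E - {c, f} \<union> {c', f'}) v = vertex_degree E v"
proof -
  have one: "card {e \<in> {x, y}. v \<in> e} = (if v \<in> x \<union> y then 1 else 0)" if "x \<noteq> y" "x \<inter> y = {}" for x y
  proof (cases "v \<in> x \<union> y")
    case True
    then have "{e \<in> {x, y}. v \<in> e} = {if v \<in> x then x else y}" using that by auto
    then show ?thesis using True by simp
  next
    case False
    then have "{e \<in> {x, y}. v \<in> e} = {}" by auto
    then show ?thesis using False by simp
  qed
  have add: "card {e \<in> A \<union> B. v \<in> e} = card {e \<in> A. v \<in> e} + card {e \<in> B. v \<in> e}"
    if "finite A" "finite B" "A \<inter> B = {}" for A B
  proof -
    have "{e \<in> A \<union> B. v \<in> e} = {e \<in> A. v \<in> e} \<union> {e \<in> B. v \<in> e}" by auto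
    then show ?thesis using that by (simp only:) (intro card_Un_disjoint; auto)
  qed
  have "E = E - {c, f} \<union> {c, f}" using assms by auto
  then have "vertex_degree E v = card {e \<in> E - {c, f} \<union> {c, f}. v \<in> e}" by (simp add: vertex_degree_def)
  also have "\<dots> = card {e \<in> E - {c, f}. v \<in> e} + card {e \<in> {c, f}. v \<in> e}"
    using assms by (intro add) auto
  also have "card {e \<in> {c, f}. v \<in> e} = card {e \<in> {c', f'}. v \<in> e}"
    unfolding one[OF assms(4,5)] one[OF assms(8,9)] assms(10) ..
  also have "card {e \<in> E - {c, f}. v \<in> e} + card {e \<in> {c', f'}. v \<in> e} =
      card {e \<in> E - {c, f} \<union> {c', f'}. v \<in> e}"
    using assms by (intro add[symmetric]) auto
  finally show ?thesis by (simp add: vertex_degree_def)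
qed

lemma card_Sigma_le:
  assumes "finite S" "\<And>x. x \<in> S \<Longrightarrow> finite (N x)" "\<And>x. x \<in> S \<Longrightarrow> card (N x) \<le> r"
  shows "card (Sigma S N) \<le> card S * r"
  using assms sum_bounded_above[of S "\<lambda>x. card (N x)" r] by (simp add: card_SigmaI)

context
  fixes r n :: nat
begin

abbreviation (input) vertices :: "(nat + nat) set" where
  "vertices \<equiv> {..<n} <+> {..<n}"

lemma bipartite_edge_iff:
  "{x, y} \<in> {{Inl a, Inr b} |a b. a < n \<and> b < n} \<longleftrightarrow> x \<in> vertices \<and> y \<in> vertices \<and> isl x \<noteq> isl y"
  by (cases x; cases y) (auto simp: doubleton_eq_iff)

lemma regular_bipartite_graphs_simple:
  assumes "E \<in> regular_bipartite_graphs r n"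
  shows "simple_edges E" "\<Union>E \<subseteq> vertices"
    "\<And>v. v \<in> vertices \<Longrightarrow> card (neighbours E v) = r" "\<And>v. card (neighbours E v) \<le> r"
    "\<And>x y. {x, y} \<in> E \<Longrightarrow> x \<in> vertices \<and> y \<in> vertices \<and> isl x \<noteq> isl y"
proof -
  let ?U = "{{Inl a, Inr b} |a b. a < n \<and> b < n} :: (nat + nat) set set"
  have U: "E \<subseteq> ?U" using assms by (simp add: regular_bipartite_graphs_def)
  have "?U = (\<lambda>(a, b). {Inl a, Inr b}) ` ({..<n} \<times> {..<n})" by auto
  then have "finite ?U" by simp
  then show simple: "simple_edges E"
    using U by (auto simp: simple_edges_def intro: finite_subset)
  show "\<Union>E \<subseteq> vertices" using U by auto
  show edge: "x \<in> vertices \<and> y \<in> vertices \<and> isl x \<noteq> isl y" if "{x, y} \<in> E" for x y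
    using subsetD[OF U that] unfolding bipartite_edge_iff .
  show deg: "card (neighbours E v) = r" if "v \<in> vertices" for v
    using assms that unfolding card_neighbours[OF simple] by (auto simp: regular_bipartite_graphs_def)
  show "card (neighbours E v) \<le> r" for v
  proof (cases "v \<in> vertices")
    case False
    then have "neighbours E v = {}" using edge by (auto simp: neighbours_def)
    then show ?thesis by simp
  qed (simp add: deg)
qed

lemma card_same_side: "card {v \<in> vertices. isl v = b} = n"
proof -
  have "{v \<in> vertices. isl v = b} = (if b then Inl else Inr) ` {..<n}" by (auto split: if_splits)
  then show ?thesis by (simp add: card_image)
qed

text \<open>Arcs \<open>(s', t')\<close> along which the closing edge \<open>{s, t}\<close> of the lasso \<open>q\<close> can be switched away: the
  edges \<open>{s, t}\<close>, \<open>{s', t'}\<close> are replaced by \<open>{s, t'}\<close>, \<open>{s', t}\<close>.\<close>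
definition switch_arcs :: "nat \<Rightarrow> (nat + nat) set set \<Rightarrow> (nat + nat) list \<Rightarrow> ((nat + nat) \<times> (nat + nat)) set" where
  "switch_arcs a E q = {(s', t'). {s', t'} \<in> E \<and> isl s' = isl (q ! 0) \<and> {q ! 0, t'} \<notin> E \<and>
     {s', q ! a} \<notin> E \<and> s' \<notin> set q}"

definition switch :: "nat \<Rightarrow> (nat + nat) set set \<Rightarrow> (nat + nat) list \<Rightarrow> (nat + nat) \<times> (nat + nat) \<Rightarrow> (nat + nat) set set" where
  "switch a E q = (\<lambda>(s', t'). E - {{q ! 0, q ! a}, {s', t'}} \<union> {{q ! 0, t'}, {s', q ! a}})"

lemma finite_switch_arcs:
  assumes "E \<in> regular_bipartite_graphs r n"
  shows "finite (switch_arcs a E q)"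
proof (rule finite_subset)
  show "switch_arcs a E q \<subseteq> vertices \<times> vertices"
    using regular_bipartite_graphs_simple(5)[OF assms] by (auto simp: switch_arcs_def)
qed simp

text \<open>Of the n r arcs starting on the side of \<open>q ! 0\<close>, at most r^2 end next to
  \<open>q ! 0\<close>, at most r^2 start next to \<open>q ! a\<close>, and at most r start at each
  vertex of \<open>q\<close>.\<close>

lemma card_switch_arcs:
  assumes E: "E \<in> regular_bipartite_graphs r n"
  shows "n * r \<le> card (switch_arcs a E q) + (r * r + r * r + length q * r)"
proof -
  note simple = regular_bipartite_graphs_simple[OF E]
  let ?s = "q ! 0" and ?t = "q ! a"
  let ?A = "SIGMA s':{v \<in> vertices. isl v = isl ?s}. neighbours E s'"
  let ?B1 = "(\<lambda>(t', s'). (s', t')) ` (SIGMA t':neighbours E ?s. neighbours E t')"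
  let ?B2 = "SIGMA s':neighbours E ?t. neighbours E s'"
  let ?B3 = "SIGMA s':set q. neighbours E s'"
  note fin = finite_neighbours[OF simple(1)]
  have nbrs2: "card (Sigma (neighbours E v) (neighbours E)) \<le> r * r" for v
  proof -
    have "card (Sigma (neighbours E v) (neighbours E)) \<le> card (neighbours E v) * r"
      by (intro card_Sigma_le fin simple(4))
    also have "\<dots> \<le> r * r" by (intro mult_right_mono simple(4)) simp
    finally show ?thesis .
  qed
  have "card ?A = (\<Sum>s'\<in>{v \<in> vertices. isl v = isl ?s}. r)"
    using simple(3) fin by (subst card_SigmaI) auto
  then have "n * r = card ?A" by (simp add: card_same_side)
  also have "?A \<subseteq> switch_arcs a E q \<union> ?B1 \<union> ?B2 \<union> ?B3"
    by (auto simp: switch_arcs_def neighbours_def insert_commute image_iff)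
  then have "card ?A \<le> card (switch_arcs a E q \<union> ?B1 \<union> ?B2 \<union> ?B3)"
    using fin finite_switch_arcs[OF E] by (intro card_mono) auto
  also have "\<dots> \<le> card (switch_arcs a E q) + card ?B1 + card ?B2 + card ?B3"
    by (meson add_mono card_Un_le order_refl order_trans)
  also have "card ?B1 \<le> r * r"
    using card_image_le[of "Sigma (neighbours E ?s) (neighbours E)"] nbrs2[of ?s] fin
    by (meson finite_SigmaI order_trans)
  also have "card ?B2 \<le> r * r" by (rule nbrs2)
  also have "card ?B3 \<le> length q * r"
  proof -
    have "card ?B3 \<le> card (set q) * r" by (intro card_Sigma_le fin simple(4)) simp
    also have "\<dots> \<le> length q * r" by (intro mult_right_mono card_length) simp
    finally show ?thesis .
  qed
  finally show ?thesis by simp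
qed

text \<open>Prepares the injection in \<open>sum_card_lassos\<close>: \<open>q\<close> and the arc
  suffice to undo the switching, and the new edges leave at most r choices each for
  \<open>s'\<close> and \<open>t'\<close>.\<close>

lemma switch_properties:
  assumes E: "E \<in> regular_bipartite_graphs r n" and q: "q \<in> lassos vertices E l a"
    and a: "2 \<le> a" "a \<le> l" and st: "(s', t') \<in> switch_arcs a E q"
  shows "switch a E q (s', t') \<in> regular_bipartite_graphs r n"
    and "q \<in> walks vertices (switch a E q (s', t')) l"
    and "s' \<in> neighbours (switch a E q (s', t')) (q ! a)"
    and "t' \<in> neighbours (switch a E q (s', t')) (q ! 0)"
    and "E = switch a E q (s', t') - {{q ! 0, t'}, {s', q ! a}} \<union> {{q ! 0, q ! a}, {s', t'}}"
proof -
  note simple = regular_bipartite_graphs_simple[OF E]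
  let ?U = "{{Inl a, Inr b} |a b. a < n \<and> b < n} :: (nat + nat) set set"
  let ?s = "q ! 0" and ?t = "q ! a"
  let ?E' = "switch a E q (s', t')"
  have E': "?E' = E - {{?s, ?t}, {s', t'}} \<union> {{?s, t'}, {s', ?t}}" by (simp add: switch_def)
  have c: "{?s, ?t} \<in> E" and len: "length q = Suc l" and dist: "distinct q"
    and path: "path_edges q \<subseteq> E" and last: "last q \<in> vertices"
    using q by (auto simp: lassos_def)
  have f: "{s', t'} \<in> E" and side: "isl s' = isl ?s" and new: "{?s, t'} \<notin> E" "{s', ?t} \<notin> E"
    and s': "s' \<notin> set q"
    using st by (auto simp: switch_arcs_def)
  have s_in: "?s \<in> set q" using len by (cases q) auto
  have ne: "s' \<noteq> ?s" "t' \<noteq> ?t" using new f c by auto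
  have sides: "isl ?t \<noteq> isl ?s" "isl t' \<noteq> isl ?s" "isl s' \<noteq> isl ?t" "isl s' \<noteq> isl t'"
    using simple(5)[OF c] simple(5)[OF f] side by auto
  have neq: "?s \<noteq> ?t" "?s \<noteq> t'" "s' \<noteq> ?t" "s' \<noteq> t'" using sides by metis+
  have "vertex_degree ?E' v = vertex_degree E v" for v
    unfolding E'
    by (rule vertex_degree_switch)
       (use c f new ne neq simple(1) in \<open>auto simp: simple_edges_def doubleton_eq_iff\<close>)
  moreover have "?E' \<subseteq> ?U"
  proof -
    have "{?s, t'} \<in> ?U" "{s', ?t} \<in> ?U"
      unfolding bipartite_edge_iff using simple(5)[OF c] simple(5)[OF f] sides by auto
    moreover have "E \<subseteq> ?U" using E by (simp add: regular_bipartite_graphs_def)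
    ultimately show ?thesis unfolding E' by blast
  qed
  ultimately show "?E' \<in> regular_bipartite_graphs r n"
    using E by (simp add: regular_bipartite_graphs_def)
  \<comment> \<open>As a \<ge> 2 and \<open>q\<close> is distinct, the only path edge at the tip
    \<open>q ! 0\<close> leads to \<open>q ! 1\<close>, not to \<open>q ! a\<close>.\<close>
  have "{?s, ?t} \<notin> path_edges q"
  proof
    assume in_path: "{?s, ?t} \<in> path_edges q"
    obtain x y xs where q_eq: "q = x # y # xs"
      using len a by (metis Suc_le_length_iff le_trans length_Cons numeral_2_eq_2 order_refl Suc_le_mono)
    have "?t \<in> set xs" using a len by (auto simp: q_eq nth_Cons' in_set_conv_nth numeral_2_eq_2 intro!: exI[of _ "a - 2"])
    then have "?t \<noteq> y" using dist q_eq by auto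
    moreover have "\<not> {x, ?t} \<subseteq> set (y # xs)" using dist q_eq by auto
    ultimately show False
      using in_path path_edges_subset[of "{x, ?t}" "y # xs"] by (auto simp: q_eq doubleton_eq_iff)
  qed
  moreover have "{s', t'} \<notin> path_edges q" using path_edges_subset[of "{s', t'}" q] s' by auto
  ultimately have "path_edges q \<subseteq> ?E'" using path unfolding E' by blast
  then show "q \<in> walks vertices ?E' l" using len last by (simp add: walks_def)
  show "s' \<in> neighbours ?E' ?t" "t' \<in> neighbours ?E' ?s"
    unfolding E' by (auto simp: neighbours_def insert_commute)
  show "E = ?E' - {{?s, t'}, {s', ?t}} \<union> {{?s, ?t}, {s', t'}}"
    unfolding E' using c f new by blast
qed

text \<open>Double counting of switchings: each lasso admits about n r arcs, while a given graph
  results from at most 2 n r^l walks with r^2 choices of arc ends. So the mean number of lassos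
  stays bounded as n grows.\<close>

lemma sum_card_lassos:
  assumes a: "2 \<le> a" "a \<le> l"
  shows "(\<Sum>E\<in>regular_bipartite_graphs r n. card (lassos vertices E l a)) * (n * r - (2 * r * r + Suc l * r))
    \<le> card (regular_bipartite_graphs r n) * (2 * n * r ^ l * (r * r))"
proof -
  let ?R = "regular_bipartite_graphs r n"
  define A where "A = (SIGMA E:?R. SIGMA q:lassos vertices E l a. switch_arcs a E q)"
  define B where "B = (SIGMA E:?R. SIGMA q:walks vertices E l. neighbours E (q ! a) \<times> neighbours E (q ! 0))"
  define h where "h = (\<lambda>(E, q, p). (switch a E q p, q, p :: (nat + nat) \<times> (nat + nat)))"
  note finR = finite_regular_bipartite_graphs[of r n]
  have walks: "finite (walks vertices E l)" "card (walks vertices E l) \<le> 2 * n * r ^ l" if "E \<in> ?R" for E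
    using card_walks[OF _ regular_bipartite_graphs_simple(1,4)[OF that], of vertices l]
    by (auto simp: card_Plus mult_2)
  have lassos: "finite (lassos vertices E l a)" if "E \<in> ?R" for E
    by (rule finite_subset[OF lassos_subset_walks walks(1)[OF that]])
  have inner: "finite (SIGMA q:walks vertices E l. neighbours E (q ! a) \<times> neighbours E (q ! 0))"
    "card (SIGMA q:walks vertices E l. neighbours E (q ! a) \<times> neighbours E (q ! 0)) \<le> 2 * n * r ^ l * (r * r)"
    if "E \<in> ?R" for E
  proof -
    note simple = regular_bipartite_graphs_simple[OF that]
    show "finite (SIGMA q:walks vertices E l. neighbours E (q ! a) \<times> neighbours E (q ! 0))"
      using walks(1)[OF that] finite_neighbours[OF simple(1)] by auto
    have "card (SIGMA q:walks vertices E l. neighbours E (q ! a) \<times> neighbours E (q ! 0))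
        \<le> card (walks vertices E l) * (r * r)"
      using walks(1)[OF that] finite_neighbours[OF simple(1)]
      by (intro card_Sigma_le) (auto simp: card_cartesian_product intro!: mult_mono simple(4))
    also have "\<dots> \<le> 2 * n * r ^ l * (r * r)" using walks(2)[OF that] by (rule mult_right_mono) simp
    finally show "card (SIGMA q:walks vertices E l. neighbours E (q ! a) \<times> neighbours E (q ! 0))
        \<le> 2 * n * r ^ l * (r * r)" .
  qed
  have finB: "finite B" unfolding B_def using finR inner(1) by auto
  have cardB: "card B \<le> card ?R * (2 * n * r ^ l * (r * r))"
    unfolding B_def using finR inner by (intro card_Sigma_le)
  have "h ` A \<subseteq> B"
    unfolding A_def B_def h_def using switch_properties(1-4)[OF _ _ a] by fastforce
  moreover have "inj_on h A"
  proof (rule inj_onI)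
    fix x y assume x: "x \<in> A" and y: "y \<in> A" and xy: "h x = h y"
    obtain E q s t where x_eq: "x = (E, q, s, t)" by (metis prod.exhaust)
    obtain E' q' s' t' where y_eq: "y = (E', q', s', t')" by (metis prod.exhaust)
    have "E = E'"
      using switch_properties(5)[OF _ _ a, of E q s t] switch_properties(5)[OF _ _ a, of E' q' s' t'] x y xy
      unfolding x_eq y_eq A_def h_def by auto
    then show "x = y" using xy by (simp add: x_eq y_eq h_def)
  qed
  ultimately have "card A \<le> card B" using card_inj_on_le finB by blast
  have cardA: "card A = (\<Sum>E\<in>?R. \<Sum>q\<in>lassos vertices E l a. card (switch_arcs a E q))"
    unfolding A_def using finR lassos finite_switch_arcs by (simp add: card_SigmaI)
  have "(\<Sum>E\<in>?R. card (lassos vertices E l a)) * (n * r - (2 * r * r + Suc l * r)) =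
      (\<Sum>E\<in>?R. \<Sum>q\<in>lassos vertices E l a. n * r - (2 * r * r + Suc l * r))"
    by (simp add: sum_distrib_right)
  also have "\<dots> \<le> card A"
    unfolding cardA
  proof (intro sum_mono)
    fix E q assume E: "E \<in> ?R" and q: "q \<in> lassos vertices E l a"
    then have "length q = Suc l" by (simp add: lassos_def)
    then show "n * r - (2 * r * r + Suc l * r) \<le> card (switch_arcs a E q)"
      using card_switch_arcs[OF E, of a q] by simp
  qed
  also note \<open>card A \<le> card B\<close>
  also note cardB
  finally show ?thesis .
qed

end

section \<open>Random regular bipartite graphs\<close>

text \<open>Only the left part is recorded, because the logarithmic derivative is a sum over that
  part.\<close>

definition bad_vertices :: "nat \<Rightarrow> nat \<Rightarrow> nat \<Rightarrow> (nat + nat) set set \<Rightarrow> nat set" where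
  "bad_vertices r n s E = {a. a < n \<and> \<not> tree_like r s r E (Inl a)}"

lemma finite_bad_vertices: "finite (bad_vertices r n s E)"
  by (simp add: bad_vertices_def)

lemma bad_vertices_mono: "s \<le> s' \<Longrightarrow> bad_vertices r n s E \<subseteq> bad_vertices r n s' E"
  using tree_like_antimono by (fastforce simp: bad_vertices_def)

text \<open>Exploring from the one-vertex path, every bad vertex is the start of a lasso with at
  most s + 1 vertices.\<close>

lemma card_bad_vertices_le:
  assumes E: "E \<in> regular_bipartite_graphs r n"
  shows "card (bad_vertices r n s E) \<le> (\<Sum>l\<le>s. \<Sum>a=2..l. card (lassos ({..<n} <+> {..<n}) E l a))"
proof -
  let ?V = "{..<n} <+> {..<n}"
  note simple = regular_bipartite_graphs_simple[OF E]
  have fin: "finite (lassos ?V E l a)" for l a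
    by (rule finite_subset[OF lassos_subset_walks]) (use card_walks[OF _ simple(1,4), of ?V] in auto)
  have "(Inl ` bad_vertices r n s E :: (nat + nat) set) \<subseteq> (\<Union>l\<le>s. \<Union>a\<in>{2..l}. last ` lassos ?V E l a)"
  proof
    fix v :: "nat + nat" assume "v \<in> Inl ` bad_vertices r n s E"
    then have v: "v \<in> ?V" "\<not> tree_like r s r E v" by (auto simp: bad_vertices_def)
    have "\<exists>q a. 2 \<le> a \<and> a < length q \<and> length q \<le> length [v] + s \<and> last q = last [v] \<and> distinct q \<and>
        path_edges q \<subseteq> E \<and> {q ! 0, q ! a} \<in> E"
      using v by (intro not_tree_like_lasso[OF simple(1,2,3)]) auto
    then obtain q a where q: "2 \<le> a" "a < length q" "length q \<le> Suc s" "last q = v" "distinct q"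
        "path_edges q \<subseteq> E" "{q ! 0, q ! a} \<in> E"
      by auto
    then have "q \<in> lassos ?V E (length q - 1) a" using v by (auto simp: lassos_def)
    then show "v \<in> (\<Union>l\<le>s. \<Union>a\<in>{2..l}. last ` lassos ?V E l a)"
      using q by (intro UN_I[of "length q - 1"] UN_I[of a] image_eqI[of _ _ q]) auto
  qed
  then have "card (Inl ` bad_vertices r n s E :: (nat + nat) set) \<le> card (\<Union>l\<le>s. \<Union>a\<in>{2..l}. last ` lassos ?V E l a)"
    using fin by (intro card_mono) auto
  also have "\<dots> \<le> (\<Sum>l\<le>s. card (\<Union>a\<in>{2..l}. last ` lassos ?V E l a))" by (intro card_UN_le) simp
  also have "\<dots> \<le> (\<Sum>l\<le>s. \<Sum>a=2..l. card (last ` lassos ?V E l a))" by (intro sum_mono card_UN_le) simp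
  also have "\<dots> \<le> (\<Sum>l\<le>s. \<Sum>a=2..l. card (lassos ?V E l a))" by (intro sum_mono card_image_le fin)
  finally show ?thesis by (simp add: card_image)
qed

text \<open>For such n at least half of the n r arcs permit a switching, so the factor n r cancels
  at the cost of a factor 2 and the bound is free of n.\<close>

lemma sum_card_bad_vertices:
  assumes r: "r \<ge> 1" and n: "n > 2 * (2 * r * r + Suc s * r)"
  shows "(\<Sum>E\<in>regular_bipartite_graphs r n. card (bad_vertices r n s E)) \<le>
    card (regular_bipartite_graphs r n) * (\<Sum>l\<le>s. \<Sum>a=2..l. 4 * r ^ Suc l)"
proof -
  let ?R = "regular_bipartite_graphs r n" and ?V = "{..<n} <+> {..<n}"
  have lasso: "(\<Sum>E\<in>?R. card (lassos ?V E l a)) \<le> card ?R * (4 * r ^ Suc l)"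
    if "l \<le> s" "2 \<le> a" "a \<le> l" for l a
  proof -
    let ?K = "2 * r * r + Suc l * r" and ?T = "\<Sum>E\<in>?R. card (lassos ?V E l a)"
    have "Suc l * r \<le> Suc s * r" using that by (intro mult_right_mono) auto
    then have "2 * ?K \<le> 2 * (2 * r * r + Suc s * r)" by (intro mult_left_mono add_left_mono) simp_all
    also have "\<dots> \<le> n" using n by (rule less_imp_le)
    also have "n \<le> n * r" using r by simp
    finally have K: "2 * ?K \<le> n * r" .
    have "N \<le> 2 * (N - K)" if "2 * K \<le> N" for N K :: nat using that by linarith
    from this[OF K] have "n * r \<le> 2 * (n * r - ?K)" .
    then have "?T * (n * r) \<le> ?T * (2 * (n * r - ?K))" by (rule mult_left_mono) simp
    also have "\<dots> = 2 * (?T * (n * r - ?K))" by (simp only: mult_ac)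
    also have "\<dots> \<le> 2 * (card ?R * (2 * n * r ^ l * (r * r)))"
      by (intro mult_left_mono sum_card_lassos that) simp
    also have "\<dots> = card ?R * (4 * r ^ Suc l) * (n * r)" by (simp add: mult_ac)
    finally show ?thesis using n r by simp
  qed
  have "(\<Sum>E\<in>?R. card (bad_vertices r n s E)) \<le> (\<Sum>E\<in>?R. \<Sum>l\<le>s. \<Sum>a=2..l. card (lassos ?V E l a))"
    by (intro sum_mono card_bad_vertices_le)
  also have "\<dots> = (\<Sum>l\<le>s. \<Sum>E\<in>?R. \<Sum>a=2..l. card (lassos ?V E l a))" by (rule sum.swap)
  also have "\<dots> = (\<Sum>l\<le>s. \<Sum>a=2..l. \<Sum>E\<in>?R. card (lassos ?V E l a))"
    by (intro sum.cong refl sum.swap)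
  also have "\<dots> \<le> (\<Sum>l\<le>s. \<Sum>a=2..l. card ?R * (4 * r ^ Suc l))"
    by (intro sum_mono lasso) auto
  also have "\<dots> = card ?R * (\<Sum>l\<le>s. \<Sum>a=2..l. 4 * r ^ Suc l)" by (simp only: sum_distrib_left)
  finally show ?thesis .
qed

text \<open>A circulant graph: a is joined to b when (b - a) mod n < r. The residue \<open>d\<close>
  is a permutation in each argument.\<close>

lemma regular_bipartite_graphs_nonempty:
  assumes "r \<le> n"
  shows "regular_bipartite_graphs r n \<noteq> {}"
proof -
  define d where "d = (\<lambda>a b. if a \<le> b then b - a else b + n - a)"
  define E :: "(nat + nat) set set" where "E = {{Inl a, Inr b} |a b. a < n \<and> b < n \<and> d a b < r}"
  have preimage: "card {x. x < n \<and> f x < r} = r" if inj: "inj_on f {..<n}" and f: "f ` {..<n} \<subseteq> {..<n}" for f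
  proof -
    have surj: "f ` {..<n} = {..<n}" using endo_inj_surj[OF _ f inj] by simp
    have "f ` {x. x < n \<and> f x < r} = {..<r}"
    proof (intro equalityI subsetI)
      fix y assume "y \<in> {..<r}"
      then have "y \<in> f ` {..<n}" unfolding surj using assms by auto
      then show "y \<in> f ` {x. x < n \<and> f x < r}" using \<open>y \<in> {..<r}\<close> by auto
    qed auto
    moreover have "card (f ` {x. x < n \<and> f x < r}) = card {x. x < n \<and> f x < r}"
      by (rule card_image[OF inj_on_subset[OF inj]]) auto
    ultimately show ?thesis by simp
  qed
  have sub: "E \<subseteq> {{Inl a, Inr b} |a b. a < n \<and> b < n}" unfolding E_def by blast
  have "{{Inl a, Inr b} |a b. a < n \<and> b < n} = (\<lambda>(a, b). {Inl a, Inr b}) ` ({..<n} \<times> {..<n})" by auto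
  then have "finite {{Inl a, Inr b} |a b. a < n \<and> b < n}" by simp
  then have simple: "simple_edges E"
    using sub by (auto simp: simple_edges_def intro: finite_subset)
  have "neighbours E (Inl a) = Inr ` {b. b < n \<and> d a b < r}" if "a < n" for a
    using that by (auto simp: neighbours_def E_def doubleton_eq_iff)
  moreover have "card {b. b < n \<and> d a b < r} = r" if "a < n" for a
    using that by (intro preimage) (auto simp: d_def inj_on_def split: if_splits)
  ultimately have left: "vertex_degree E (Inl a) = r" if "a < n" for a
    using that by (simp add: card_neighbours[OF simple, symmetric] card_image)
  have "neighbours E (Inr b) = Inl ` {a. a < n \<and> d a b < r}" if "b < n" for b
    using that by (auto simp: neighbours_def E_def doubleton_eq_iff)
  moreover have "card {a. a < n \<and> d a b < r} = r" if "b < n" for b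
    using that by (intro preimage) (auto simp: d_def inj_on_def split: if_splits)
  ultimately have right: "vertex_degree E (Inr b) = r" if "b < n" for b
    using that by (simp add: card_neighbours[OF simple, symmetric] card_image)
  have "E \<in> regular_bipartite_graphs r n"
    using sub left right by (auto simp: regular_bipartite_graphs_def)
  then show ?thesis by blast
qed

section \<open>Good graphs and probability\<close>

text \<open>One parameter bounds both depth and size. The threshold sqrt n is o(n), so bad vertices
  vanish in averages, and it is unbounded, so almost all graphs pass. Along the resulting filter,
  statements with high probability become ordinary limits.\<close>

definition good_graphs :: "nat \<Rightarrow> nat \<Rightarrow> (nat \<times> (nat + nat) set set) set" where
  "good_graphs r s = {(n, E). s \<le> n \<and> E \<in> regular_bipartite_graphs r n \<and>
     real (card (bad_vertices r n s E)) \<le> sqrt (real n)}"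

definition good_filter :: "nat \<Rightarrow> (nat \<times> (nat + nat) set set) filter" where
  "good_filter r = (INF s. principal (good_graphs r s))"

lemma good_graphs_antimono: "s \<le> s' \<Longrightarrow> good_graphs r s' \<subseteq> good_graphs r s"
proof
  fix x assume s: "s \<le> s'" and "x \<in> good_graphs r s'"
  then obtain n E where x: "x = (n, E)" and n: "s' \<le> n" and E: "E \<in> regular_bipartite_graphs r n"
    and bad: "real (card (bad_vertices r n s' E)) \<le> sqrt (real n)"
    by (auto simp: good_graphs_def)
  have "card (bad_vertices r n s E) \<le> card (bad_vertices r n s' E)"
    by (rule card_mono[OF finite_bad_vertices bad_vertices_mono[OF s]])
  then show "x \<in> good_graphs r s" using s n E bad by (simp add: good_graphs_def x)
qed

lemma eventually_good_filter:
  "eventually P (good_filter r) \<longleftrightarrow> (\<exists>s. \<forall>x\<in>good_graphs r s. P x)"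
  unfolding good_filter_def
proof (subst eventually_INF_base)
  show "\<exists>x\<in>UNIV. principal (good_graphs r x) \<le> inf (principal (good_graphs r a)) (principal (good_graphs r b))"
    for a b
    using good_graphs_antimono[of a "max a b" r] good_graphs_antimono[of b "max a b" r] by auto
qed (auto simp: eventually_principal)

text \<open>Markov's inequality: the mean number of bad vertices is at most C, free of n, so more
  than sqrt n of them occur with probability at most C / sqrt n.\<close>

lemma good_prob_tendsto:
  assumes r: "r \<ge> 1" and P: "eventually (\<lambda>(n, E). P E) (good_filter r)"
  shows "(\<lambda>n. measure_pmf.prob (random_regular_bipartite_graph r n) {E. P E}) \<longlonglongrightarrow> 1"
proof -
  obtain s where s: "\<And>n E. (n, E) \<in> good_graphs r s \<Longrightarrow> P E"
    using P unfolding eventually_good_filter by auto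
  define C where "C = real (\<Sum>l\<le>s. \<Sum>a=2..l. 4 * r ^ Suc l)"
  \<comment> \<open>The summand r in the bound on n makes graphs exist, s is the size condition of
    \<open>good_graphs\<close>, and the rest is the range of
    \<open>sum_card_bad_vertices\<close>.\<close>
  have lower: "1 - C / sqrt (real n) \<le> measure_pmf.prob (random_regular_bipartite_graph r n) {E. P E}"
    if n: "n > 2 * (2 * r * r + Suc s * r) + r + s" for n
  proof -
    let ?R = "regular_bipartite_graphs r n"
    let ?B = "{E \<in> ?R. sqrt (real n) < real (card (bad_vertices r n s E))}"
    have ne: "?R \<noteq> {}" using n by (intro regular_bipartite_graphs_nonempty) auto
    note fin = finite_regular_bipartite_graphs[of r n]
    have pos: "card ?R > 0" "sqrt (real n) > 0" using ne fin n by (auto simp: card_gt_0_iff)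
    have "real (card ?B) * sqrt (real n) = (\<Sum>E\<in>?B. sqrt (real n))" by simp
    also have "\<dots> \<le> (\<Sum>E\<in>?B. real (card (bad_vertices r n s E)))" by (intro sum_mono) auto
    also have "\<dots> \<le> (\<Sum>E\<in>?R. real (card (bad_vertices r n s E)))" using fin by (intro sum_mono2) auto
    also have "\<dots> \<le> real (card ?R) * C"
      using sum_card_bad_vertices[OF r, of s n] n
      unfolding C_def of_nat_sum[symmetric] of_nat_mult[symmetric] of_nat_le_iff by simp
    finally have "real (card ?B) / real (card ?R) \<le> C / sqrt (real n)"
      using pos by (simp add: field_simps)
    moreover have "P E" if "E \<in> ?R - ?B" for E
      using that n by (intro s[of n]) (auto simp: good_graphs_def)
    then have "?R - ?B \<subseteq> ?R \<inter> {E. P E}" by blast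
    then have "card (?R - ?B) \<le> card (?R \<inter> {E. P E})" using fin by (intro card_mono) auto
    then have "real (card ?R) - real (card ?B) \<le> real (card (?R \<inter> {E. P E}))"
      using fin card_mono[of ?R ?B] by (simp add: card_Diff_subset)
    then have "(real (card ?R) - real (card ?B)) / real (card ?R) \<le>
        real (card (?R \<inter> {E. P E})) / real (card ?R)"
      by (rule divide_right_mono) simp
    ultimately show ?thesis
      unfolding random_regular_bipartite_graph_def measure_pmf_of_set[OF ne fin]
      using pos by (simp add: diff_divide_distrib)
  qed
  have "(\<lambda>n. 1 - C * inverse (sqrt (real n))) \<longlonglongrightarrow> 1 - C * 0"
    by (intro tendsto_intros tendsto_inverse_0_at_top filterlim_compose[OF sqrt_at_top filterlim_real_sequentially])
  then have lim: "(\<lambda>n. 1 - C / sqrt (real n)) \<longlonglongrightarrow> 1" by (simp add: divide_inverse)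
  show ?thesis
  proof (rule tendsto_sandwich[OF _ _ lim tendsto_const])
    show "eventually (\<lambda>n. 1 - C / sqrt (real n) \<le>
        measure_pmf.prob (random_regular_bipartite_graph r n) {E. P E}) sequentially"
      by (rule eventually_mono[OF eventually_gt_at_top lower])
  qed simp
qed

section \<open>Applying the scaling analysis to matchings\<close>

text \<open>Coefficient j + 1 of t M'(t) = D(t) M(t), where D sums \<open>1 - del_ratio\<close> over
  the left part. D has no constant term, hence the index \<open>Suc s\<close>.\<close>

lemma matching_fps_log_deriv:
  assumes E: "E \<in> regular_bipartite_graphs r n"
  shows "real (Suc j) * real (num_matchings E (Suc j)) =
    (\<Sum>s\<le>j. fps_nth (\<Sum>a<n. 1 - del_ratio E (Inl a)) (Suc s) * real (num_matchings E (j - s)))"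
proof -
  note simple = regular_bipartite_graphs_simple[OF E]
  let ?S = "Inl ` {..<n} :: (nat + nat) set" and ?D = "\<Sum>a<n. 1 - del_ratio E (Inl a)"
  have meet: "card (e \<inter> ?S) = 1" if e: "e \<in> E" for e
  proof -
    obtain a b where "e = {Inl a, Inr b}" "a < n"
      using e E by (auto simp: regular_bipartite_graphs_def)
    then have "e \<inter> ?S = {Inl a}" by auto
    then show ?thesis by simp
  qed
  have count: "(\<Sum>a<n. real (num_matchings (del_vertex E (Inl a)) (Suc j))) +
      real (Suc j) * real (num_matchings E (Suc j)) = real n * real (num_matchings E (Suc j))"
  proof -
    have "(\<Sum>v\<in>?S. num_matchings (del_vertex E v) (Suc j)) + Suc j * num_matchings E (Suc j) =
        card ?S * num_matchings E (Suc j)"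
      using simple(1) meet by (intro sum_num_matchings_del_vertex) (auto simp: simple_edges_def)
    then have "(\<Sum>a<n. num_matchings (del_vertex E (Inl a)) (Suc j)) + Suc j * num_matchings E (Suc j) =
        n * num_matchings E (Suc j)"
      by (simp add: sum.reindex card_image)
    then show ?thesis by (metis of_nat_add of_nat_mult of_nat_sum)
  qed
  have "?D * matching_fps E = (\<Sum>a<n. matching_fps E - matching_fps (del_vertex E (Inl a)))"
  proof -
    have "del_ratio E v * matching_fps E = matching_fps (del_vertex E v)" for v
      unfolding del_ratio_def using matching_fps_inverse[of E] by (metis mult.assoc mult.commute mult_1_right)
    then show ?thesis by (simp only: sum_distrib_right left_diff_distrib mult_1_left)
  qed
  then have "fps_nth (?D * matching_fps E) (Suc j) = real (Suc j) * real (num_matchings E (Suc j))"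
    using count by (simp add: fps_sum_nth matching_fps_def sum_subtractf)
  moreover have D0: "fps_nth ?D 0 = 0"
    using fps_reciprocal_nth(1)[OF del_ratio_rec[OF simple(1)]] by (simp add: fps_sum_nth)
  have "fps_nth (?D * matching_fps E) (Suc j) =
      (\<Sum>s=0..j. fps_nth ?D (Suc s) * real (num_matchings E (j - s)))"
    unfolding fps_mult_nth sum.atLeast0_atMost_Suc_shift D0 by (simp add: matching_fps_def)
  ultimately show ?thesis by (simp add: atMost_atLeast0)
qed

lemma eventually_good_pos:
  assumes r: "r \<ge> 1" and k: "k \<ge> 2"
  shows "eventually (\<lambda>(n, E). (fwd_diff ^^ k) (neg_ln_matchings E) i > 0) (good_filter r)"
proof -
  let ?F = "good_filter r"
  define \<nu> where "\<nu> = (\<lambda>(n, E :: (nat + nat) set set). real n)"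
  \<comment> \<open>Normalised so that \<open>\<nu> x ^ j * X x j\<close> is j! m_j, the argument of
    the logarithm.\<close>
  define X where "X = (\<lambda>(n, E :: (nat + nat) set set) j. fact j * real (num_matchings E j) / real n ^ j)"
  define d where "d = (\<lambda>(n, E :: (nat + nat) set set) s.
    fps_nth (\<Sum>a<n. 1 - del_ratio E (Inl a)) (Suc s) / real n)"
  have \<nu>: "filterlim \<nu> at_top ?F"
    unfolding filterlim_at_top eventually_good_filter
  proof
    fix Z :: real
    show "\<exists>s. \<forall>x\<in>good_graphs r s. Z \<le> \<nu> x"
      by (intro exI[of _ "nat \<lceil>Z\<rceil>"]) (auto simp: good_graphs_def \<nu>_def)
  qed
  interpret scaling ?F \<nu> by unfold_locales (rule \<nu>)
  have good: "eventually (\<lambda>(n, E). n > 0 \<and> E \<in> regular_bipartite_graphs r n \<and>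
      real (card (bad_vertices r n s E)) \<le> sqrt (real n)) ?F" for s
    unfolding eventually_good_filter
  \<comment> \<open>\<open>Suc s\<close> instead of s forces n > 0.\<close>
  proof (intro exI[of _ "Suc s"] ballI)
    fix x assume "x \<in> good_graphs r (Suc s)"
    then show "case x of (n, E) \<Rightarrow> n > 0 \<and> E \<in> regular_bipartite_graphs r n \<and>
      real (card (bad_vertices r n s E)) \<le> sqrt (real n)"
      using good_graphs_antimono[of s "Suc s" r] by (auto simp: good_graphs_def)
  qed
  have X0: "X x 0 = 1" for x
    by (cases x) (simp add: X_def num_matchings_0)
  have rec: "eventually (\<lambda>x. X x (Suc j) =
      (\<Sum>s\<le>j. d x s * X x (j - s) * (fact j / fact (j - s)) / \<nu> x ^ s)) ?F" for j
    using good[of 0]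
  proof eventually_elim
    case (elim x)
    obtain n E where x: "x = (n, E)" by (cases x)
    have n: "n > 0" and E: "E \<in> regular_bipartite_graphs r n" using elim x by auto
    have "X x (Suc j) = fact j / real n ^ Suc j * (real (Suc j) * real (num_matchings E (Suc j)))"
      by (simp add: X_def x)
    also have "\<dots> = (\<Sum>s\<le>j. fact j / real n ^ Suc j *
        (fps_nth (\<Sum>a<n. 1 - del_ratio E (Inl a)) (Suc s) * real (num_matchings E (j - s))))"
      unfolding matching_fps_log_deriv[OF E] sum_distrib_left ..
    also have "\<dots> = (\<Sum>s\<le>j. d x s * X x (j - s) * (fact j / fact (j - s)) / \<nu> x ^ s)"
    proof (rule sum.cong)
      fix s assume "s \<in> {..j}"
      then have "real n ^ Suc j = real n * real n ^ (j - s) * real n ^ s"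
        by (simp add: power_add[symmetric] mult.assoc)
      then show "fact j / real n ^ Suc j *
          (fps_nth (\<Sum>a<n. 1 - del_ratio E (Inl a)) (Suc s) * real (num_matchings E (j - s))) =
          d x s * X x (j - s) * (fact j / fact (j - s)) / \<nu> x ^ s"
        using n by (simp add: d_def X_def \<nu>_def x mult_ac)
    qed simp
    finally show ?case .
  qed
  \<comment> \<open>Tree-like vertices contribute exactly the tree coefficient. The others number at
    most sqrt n and err by at most C' each, so the average errs by at most C' / sqrt n.\<close>
  have lim: "((\<lambda>x. d x s) \<longlongrightarrow> fps_nth (fps_shift 1 (tree_density r)) s) ?F" for s
  proof -
    obtain C where C: "\<And>E v. simple_edges (E :: (nat + nat) set set) \<Longrightarrow>
        (\<And>w. card (neighbours E w) \<le> r) \<Longrightarrow> \<bar>fps_nth (del_ratio E v) (Suc s)\<bar> \<le> C"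
      using del_ratio_bounded[of r "Suc s", where 'a = "nat + nat"] by blast
    define C' where "C' = C + \<bar>fps_nth (tree_root r) (Suc s)\<bar>"
    have "eventually (\<lambda>x. norm (d x s - fps_nth (fps_shift 1 (tree_density r)) s) \<le>
        C' * inverse (sqrt (\<nu> x))) ?F"
      using good[of "Suc s"]
    proof eventually_elim
      case (elim x)
      obtain n E where x: "x = (n, E)" by (cases x)
      have n: "n > 0" and E: "E \<in> regular_bipartite_graphs r n"
        and bad: "real (card (bad_vertices r n (Suc s) E)) \<le> sqrt (real n)" using elim x by auto
      note simple = regular_bipartite_graphs_simple[OF E]
      let ?e = "\<lambda>a. fps_nth (tree_root r) (Suc s) - fps_nth (del_ratio E (Inl a)) (Suc s)"
      have e: "\<bar>?e a\<bar> \<le> C'" for a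
        using C[OF simple(1,4), of "Inl a"] by (simp add: C'_def)
      have e0: "?e a = 0" if "a \<in> {..<n} - bad_vertices r n (Suc s) E" for a
        using that del_ratio_tree_like[OF simple(1) _ tree_recursion[OF r], of "Suc s" "Inl a" "Suc s"]
        by (auto simp: bad_vertices_def)
      have "d x s - fps_nth (fps_shift 1 (tree_density r)) s = (\<Sum>a<n. ?e a) / real n"
        using n by (simp add: d_def x fps_sum_nth tree_root_def sum_subtractf sum_negf field_simps)
      moreover have "\<bar>\<Sum>a<n. ?e a\<bar> \<le> C' * sqrt (real n)"
      proof -
        have "(\<Sum>a<n. ?e a) = (\<Sum>a\<in>bad_vertices r n (Suc s) E. ?e a)"
          using e0 by (intro sum.mono_neutral_right) (auto simp: bad_vertices_def)
        also have "\<bar>\<dots>\<bar> \<le> (\<Sum>a\<in>bad_vertices r n (Suc s) E. C')"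
          by (rule order_trans[OF sum_abs sum_mono]) (rule e)
        also have "\<dots> \<le> C' * sqrt (real n)"
          using mult_right_mono[OF bad, of C'] order_trans[OF abs_ge_zero e[of 0]] by (simp add: mult.commute)
        finally show ?thesis .
      qed
      ultimately have "norm (d x s - fps_nth (fps_shift 1 (tree_density r)) s) \<le> C' * sqrt (real n) / real n"
        using n by (simp add: divide_right_mono)
      also have "\<dots> = C' * inverse (sqrt (\<nu> x))"
        using n by (simp add: \<nu>_def x real_div_sqrt field_simps)
      finally show ?case .
    qed
    moreover have "((\<lambda>x. C' * inverse (sqrt (\<nu> x))) \<longlongrightarrow> C' * 0) ?F"
      by (intro tendsto_intros tendsto_inverse_0_at_top filterlim_compose[OF sqrt_at_top \<nu>])
    ultimately have "((\<lambda>x. d x s - fps_nth (fps_shift 1 (tree_density r)) s) \<longlongrightarrow> 0) ?F"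
      unfolding mult_zero_right by (rule Lim_null_comparison)
    then show ?thesis by (rule LIM_zero_cancel)
  qed
  have G: "fps_nth (bethe r) 0 > 0" using r by (simp add: bethe_nth_0)
  \<comment> \<open>Here T = p/G with G = \<open>bethe r\<close>, and D = P(t)/t with P =
    \<open>tree_density r\<close>.\<close>
  note ratio = smooth_upto_ratio[OF X0 rec lim bethe_inverse[OF r] tree_density_shift_compose[OF r] G]
  have "eventually (\<lambda>x. (fwd_diff ^^ k) (\<lambda>j. - ln (\<nu> x ^ j * X x j)) i > 0) ?F"
    by (rule eventually_fwd_diff_neg_ln_pos[OF ratio G bethe_log_deriv_neg[OF r] k])
  with good[of 0] show ?thesis
  proof eventually_elim
    case (elim x)
    obtain n E where x: "x = (n, E)" by (cases x)
    have "(\<lambda>j. - ln (\<nu> x ^ j * X x j)) = neg_ln_matchings E"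
      using elim by (simp add: fun_eq_iff neg_ln_matchings_def \<nu>_def X_def x)
    then show ?case using elim by (simp add: x)
  qed
qed

theorem theoremI1:
  fixes r i k :: nat
  assumes "r \<ge> 1" and "k \<ge> 2"
    and "(r \<le> 10 \<and> i + k \<le> 100 \<and> 2 \<le> k \<and> k \<le> 27) \<or> i + k \<le> 29"
  shows "(\<lambda>n. measure_pmf.prob (random_regular_bipartite_graph r n)
                {G. (fwd_diff ^^ k) (neg_ln_matchings G) i \<ge> 0}) \<longlonglongrightarrow> 1"
proof (rule good_prob_tendsto[OF assms(1)])
  show "eventually (\<lambda>(n, G). (fwd_diff ^^ k) (neg_ln_matchings G) i \<ge> 0) (good_filter r)"
    using eventually_good_pos[OF assms(1,2), of i] by (auto elim: eventually_mono)
qed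

end
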